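(* Let $\Omega \subset \mathbb{R}^N$ ($N \ge 3$) be a smooth bounded domain, let $0 < r < 1$, and let $2+\frac{4}{N} < p < 2^* := \frac{2N}{N-2}$. Then there exists $\rho_0 > 0$ such that for every $\rho \in (0, \rho_0)$ the problem \[ \begin{cases} -\Delta u + \lambda u = u^{-r} + u^{p-1} & \text{in } \Omega, \\ u = 0 & \text{on } \partial\Omega, \\ \displaystyle \int_\Omega |u|^2 \, dx = \rho, \end{cases} \] admits a solution $(\lambda, u) \in \mathbb{R} \times H_0^1(\Omega)$ with $u > 0$ in $\Omega$.
   Context: Here $\lambda\in\mathbb{R}$ is an unknown (Lagrange multiplier). A solution is understood in the weak sense: $u\in H_0^1(\Omega)$, $u>0$ in $\Omega$, $\int_\Omega u^2\,dx=\rho$, and $\int_\Omega \nabla u\cdot\nabla\varphi\,dx+\lambda\int_\Omega u\varphi\,dx=\int_\Omega u^{-r}\varphi\,dx+\int_\Omega u^{p-1}\varphi\,dx$ for all $\varphi\in C_c^\infty(\Omega)$. *)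

theory Defs
  imports "HOL-Analysis.Analysis"
begin

definition pderiv_dir :: "'n::finite \<Rightarrow> (real^'n \<Rightarrow> real) \<Rightarrow> real^'n \<Rightarrow> real" where
  "pderiv_dir i f x = frechet_derivative f (at x) (axis i 1)"

fun iter_pderiv :: "'n::finite list \<Rightarrow> (real^'n \<Rightarrow> real) \<Rightarrow> real^'n \<Rightarrow> real" where
  "iter_pderiv [] f = f"
| "iter_pderiv (i # is) f = pderiv_dir i (iter_pderiv is f)"

definition smooth_on :: "(real^'n::finite \<Rightarrow> real) \<Rightarrow> (real^'n) set \<Rightarrow> bool" where
  "smooth_on f U \<longleftrightarrow> (\<forall>is. \<forall>x\<in>U. iter_pderiv is f differentiable (at x))"

definition grad :: "(real^'n::finite \<Rightarrow> real) \<Rightarrow> real^'n \<Rightarrow> real^'n" where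
  "grad f x = (\<chi> i. pderiv_dir i f x)"

definition smooth_bounded_domain :: "(real^'n::finite) set \<Rightarrow> bool" where
  "smooth_bounded_domain \<Omega> \<longleftrightarrow> open \<Omega> \<and> bounded \<Omega> \<and> connected \<Omega> \<and> \<Omega> \<noteq> {} \<and>
     (\<forall>x0\<in>frontier \<Omega>. \<exists>U \<psi>. open U \<and> x0 \<in> U \<and> smooth_on \<psi> U \<and> grad \<psi> x0 \<noteq> 0 \<and>
        U \<inter> \<Omega> = {x\<in>U. \<psi> x < 0} \<and> U \<inter> frontier \<Omega> = {x\<in>U. \<psi> x = 0})"

definition test_fun :: "(real^'n::finite) set \<Rightarrow> (real^'n \<Rightarrow> real) \<Rightarrow> bool" where
  "test_fun \<Omega> \<phi> \<longleftrightarrow> smooth_on \<phi> UNIV \<and> compact (closure {x. \<phi> x \<noteq> 0})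
      \<and> closure {x. \<phi> x \<noteq> 0} \<subseteq> \<Omega>"

text \<open>u belongs to H_0^1(Omega) with weak gradient G: u and G are square integrable on Omega
  and (u, G) is the H^1-limit of (phi_k, grad phi_k) for test functions phi_k.\<close>
definition H01 :: "(real^'n::finite) set \<Rightarrow> (real^'n \<Rightarrow> real) \<Rightarrow> (real^'n \<Rightarrow> real^'n) \<Rightarrow> bool" where
  "H01 \<Omega> u G \<longleftrightarrow>
     u \<in> borel_measurable (lebesgue_on \<Omega>) \<and> G \<in> borel_measurable (lebesgue_on \<Omega>) \<and>
     integrable (lebesgue_on \<Omega>) (\<lambda>x. (u x)\<^sup>2) \<and>
     integrable (lebesgue_on \<Omega>) (\<lambda>x. (norm (G x))\<^sup>2) \<and>
     (\<exists>\<phi> :: nat \<Rightarrow> real^'n \<Rightarrow> real. (\<forall>k. test_fun \<Omega> (\<phi> k)) \<and>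
        (\<lambda>k. integral\<^sup>L (lebesgue_on \<Omega>) (\<lambda>x. (u x - \<phi> k x)\<^sup>2)) \<longlonglongrightarrow> 0 \<and>
        (\<lambda>k. integral\<^sup>L (lebesgue_on \<Omega>) (\<lambda>x. (norm (G x - grad (\<phi> k) x))\<^sup>2)) \<longlonglongrightarrow> 0)"

end

theory Submission
  imports Defs
begin

text \<open>
  Write \<open>h(t) = lam t^2 / 2 - t^p / p - t^(1-r) / (1-r)\<close>. On the convex set of all \<open>u\<close> in
  \<open>H\<^sub>0\<^sup>1\<close> with values in \<open>[0,1]\<close>, the functional
  \<open>J(u) = \<integral> |grad u|^2 / 2 + h(u)\<close> is strongly convex as soon as \<open>lam \<ge> p\<close>, because there the convex part
  \<open>lam t^2 / 2\<close> dominates the second derivative of \<open>t^p / p\<close>. Minimising sequences are therefore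
  Cauchy, and the minimiser is unique: no Sobolev embedding and no compactness are needed.

  The two constraints are inactive. Comparing with \<open>min u (1/2)\<close> gives \<open>u \<le> 1/2\<close> when \<open>lam \<ge> 6\<close>. A
  small paraboloid supported in a ball inside the domain is a subsolution because of the singular
  term, and comparing with the maximum of \<open>u\<close> and this paraboloid bounds \<open>u\<close> from below, locally
  uniformly. Hence two-sided variations by test functions are admissible and \<open>u\<close> solves the
  equation with multiplier \<open>lam\<close>.

  By strong convexity the mass of the minimiser is a Lipschitz function of \<open>lam\<close>; it is positive and
  tends to 0 as \<open>lam\<close> tends to infinity, so by the intermediate value theorem it takes every small
  positive value.
\<close>

section \<open>Smooth functions\<close>

text \<open>Prescribing \<open>lam\<close> and recovering the mass afterwards avoids the obstacle of
  the direct approach: for powers above 2 + 4/N the energy is unbounded below on a sphere of fixed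
  mass, since a bump may be concentrated. With values confined to [0,1] the power terms are bounded,
  so the energy is finite on the whole convex set and its zero order part is continuous under
  bounded a.e. convergence. The second obstacle is the singular power: \<open>t powr (1 - r)\<close>
  has infinite slope at 0, so the energy cannot simply be differentiated where a function may
  vanish. Convexity takes the place of the derivative: the pointwise inequality
  \<open>hfun_tangent\<close>, always taken at a positive value, compares the energies of two
  functions, both for the paraboloid and for the variations. The gap between the proved bound 1/2
  and the imposed bound 1 is the room for upward variations; the local lower bound is the room for
  downward ones. Mass and multiplier are linked because the energy is affine in \<open>lam\<close>
  with slope half the mass.\<close>

lemma smooth_on_invariant_set:
  assumes "f \<in> S"
    and "\<And>g x. g \<in> S \<Longrightarrow> g differentiable (at x)"
    and "\<And>g i. g \<in> S \<Longrightarrow> pderiv_dir i g \<in> S"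
  shows "smooth_on f U"
proof -
  have "iter_pderiv is f \<in> S" for "is"
    using assms by (induction "is") auto
  with assms(2) show ?thesis by (auto simp: smooth_on_def)
qed

lemma smooth_on_differentiable: "smooth_on f UNIV \<Longrightarrow> f differentiable (at x)"
  unfolding smooth_on_def by (metis UNIV_I iter_pderiv.simps(1))

lemma iter_pderiv_append: "iter_pderiv (is @ js) f = iter_pderiv is (iter_pderiv js f)"
  by (induction "is") auto

lemma smooth_on_pderiv_dir: "smooth_on f U \<Longrightarrow> smooth_on (pderiv_dir i f) U"
  unfolding smooth_on_def using iter_pderiv_append[of _ "[i]" f] by auto (metis)

lemma has_derivative_pderiv_dir:
  assumes "(f has_derivative f') (at x)"
  shows "pderiv_dir i f x = f' (axis i 1)"
  using frechet_derivative_at[OF assms] by (simp add: pderiv_dir_def)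

lemma inner_grad:
  assumes "(f has_derivative f') (at x)"
  shows "grad f x \<bullet> v = f' v"
proof -
  have lin: "linear f'" using assms has_derivative_linear by blast
  have "f' v = f' (\<Sum>i\<in>UNIV. v $ i *\<^sub>R axis i 1)"
    by (simp add: basis_expansion flip: scalar_mult_eq_scaleR)
  also have "\<dots> = (\<Sum>i\<in>UNIV. v $ i * f' (axis i 1))"
    by (simp add: linear_sum[OF lin] linear_scale[OF lin])
  finally show ?thesis
    by (simp add: inner_vec_def grad_def has_derivative_pderiv_dir[OF assms] mult.commute)
qed

lemma grad_eqI:
  assumes "(f has_derivative (\<lambda>v. w \<bullet> v)) (at x)"
  shows "grad f x = w"
  by (rule vector_eq_rdot[THEN iffD1]) (simp add: inner_grad[OF assms])

lemma has_derivative_grad: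
  assumes "f differentiable (at x)"
  shows "(f has_derivative (\<lambda>v. grad f x \<bullet> v)) (at x)"
  using assms inner_grad unfolding differentiable_def by (metis (no_types, lifting) ext)

text \<open>Compositions with the flat functions below replace mollification: they yield smooth
  approximations of positive parts that vanish wherever the positive part does.\<close>

definition flat :: "nat \<Rightarrow> real \<Rightarrow> real" where
  "flat n t = (if t > 0 then exp (- 1 / t) / t ^ n else 0)"

lemma flat_nonneg: "0 \<le> flat n t"
  by (simp add: flat_def)

text \<open>One term of the exponential series suffices: for t > 0, exp(1/t) is at least (1/t)^(n+1)
  / (n+1)!. The spare power of t gives the limit 0 at the origin.\<close>

lemma flat_le: "flat n t \<le> fact (Suc n) * \<bar>t\<bar>"
proof (cases "t > 0")
  case True
  have "inverse (fact (Suc n)) * (1 / t) ^ Suc n \<le> (\<Sum>k. inverse (fact k) * (1 / t) ^ k)"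
    using sum_le_suminf[of "\<lambda>k. inverse (fact k) * (1 / t) ^ k" "{Suc n}"] True summable_exp
    by auto
  then have "inverse (fact (Suc n)) * (1 / t) ^ Suc n \<le> exp (1 / t)"
    by (simp add: exp_def)
  then have "1 \<le> fact (Suc n) * t ^ Suc n * exp (1 / t)"
    using True by (simp add: power_divide divide_simps mult_ac del: fact_Suc power_Suc)
  then show ?thesis using True
    by (simp add: flat_def exp_minus divide_simps mult_ac del: fact_Suc)
next
  case False
  then have "flat n t = 0" by (simp add: flat_def)
  moreover have "0 \<le> fact (Suc n) * \<bar>t\<bar>" by (rule mult_nonneg_nonneg) simp_all
  ultimately show ?thesis by simp
qed

text \<open>The powers in the denominator are there to make the family closed under differentiation.
  At 0 the difference quotient of \<open>flat n\<close> is \<open>flat (Suc n)\<close>, which tends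
  to 0 by \<open>flat_le\<close>.\<close>

lemma flat_has_real_derivative:
  "(flat n has_real_derivative (flat (n + 2) t - real n * flat (n + 1) t)) (at t)"
proof -
  consider "t > 0" | "t < 0" | "t = 0" by linarith
  then show ?thesis
  proof cases
    case 1
    have "((\<lambda>t. exp (- 1 / t) / t ^ n) has_real_derivative (flat (n + 2) t - real n * flat (n + 1) t)) (at t)"
      using 1 by (auto intro!: derivative_eq_intros simp: flat_def field_simps power2_eq_square)
        (cases n; simp)
    moreover have "\<forall>\<^sub>F s in nhds t. flat n s = exp (- 1 / s) / s ^ n"
      using eventually_nhds_in_open[of "{0<..}" t] 1
      by (auto simp: flat_def elim!: eventually_mono)
    ultimately show ?thesis by (simp add: DERIV_cong_ev)
  next
    case 2
    have "((\<lambda>t. 0) has_real_derivative 0) (at t)" by simp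
    moreover have "\<forall>\<^sub>F s in nhds t. flat n s = 0"
      using eventually_nhds_in_open[of "{..<0}" t] 2
      by (auto simp: flat_def elim!: eventually_mono)
    ultimately show ?thesis using 2 by (simp add: DERIV_cong_ev flat_def)
  next
    case 3
    have "((\<lambda>h. flat (Suc n) h) \<longlongrightarrow> 0) (at 0)"
    proof (rule tendsto_sandwich[of "\<lambda>_. 0" _ _ "\<lambda>t. fact (Suc (Suc n)) * \<bar>t\<bar>"])
      show "((\<lambda>t::real. fact (Suc (Suc n)) * \<bar>t\<bar>) \<longlongrightarrow> 0) (at 0)"
        by (auto intro!: tendsto_eq_intros)
    qed (auto intro!: always_eventually flat_le flat_nonneg simp del: fact_Suc)
    moreover have "(flat n h - flat n 0) / h = flat (Suc n) h" if "h \<noteq> 0" for h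
      using that by (auto simp: flat_def)
    ultimately have "((\<lambda>h. (flat n h - flat n 0) / h) \<longlongrightarrow> 0) (at 0)"
      by (subst tendsto_cong[of _ "\<lambda>h. flat (Suc n) h"]) (auto simp: eventually_at_filter)
    then show ?thesis using 3 by (simp add: DERIV_def flat_def)
  qed
qed

text \<open>The rules are chosen so that sum, product and chain rule keep every partial derivative
  inside the set. By \<open>smooth_on_invariant_set\<close> all members are then smooth, without any
  formula for iterated derivatives of products or compositions. The rule \<open>base\<close> makes
  the set exactly that of the smooth functions, so the rules become closure properties of
  smoothness.\<close>

inductive_set smooth_closure :: "(real^'n::finite \<Rightarrow> real) set" where
  base: "smooth_on f UNIV \<Longrightarrow> f \<in> smooth_closure"
| const: "(\<lambda>_. c) \<in> smooth_closure"
| coord: "(\<lambda>x. x $ i) \<in> smooth_closure"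
| add: "f \<in> smooth_closure \<Longrightarrow> g \<in> smooth_closure \<Longrightarrow> (\<lambda>x. f x + g x) \<in> smooth_closure"
| mult: "f \<in> smooth_closure \<Longrightarrow> g \<in> smooth_closure \<Longrightarrow> (\<lambda>x. f x * g x) \<in> smooth_closure"
| flat: "f \<in> smooth_closure \<Longrightarrow> (\<lambda>x. flat n (f x)) \<in> smooth_closure"

lemma smooth_closure_derivative:
  fixes f :: "real^'n::finite \<Rightarrow> real"
  assumes "f \<in> smooth_closure"
  shows "f differentiable (at x) \<and> pderiv_dir i f \<in> smooth_closure"
  using assms
proof (induction arbitrary: x i)
  case (base f)
  then show ?case
    by (auto intro: smooth_on_differentiable smooth_closure.base smooth_on_pderiv_dir)
next
  case (const c)
  have "pderiv_dir i (\<lambda>_. c) = (\<lambda>_. 0)"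
    by (rule ext, subst has_derivative_pderiv_dir[OF has_derivative_const]) simp
  then show ?case by (simp add: smooth_closure.const)
next
  case (coord j)
  have *: "((\<lambda>x. x $ j) has_derivative (\<lambda>v. v $ j)) (at x)" for x :: "real^'n"
    by (rule bounded_linear_imp_has_derivative) (rule bounded_linear_vec_nth)
  have "pderiv_dir i (\<lambda>x. x $ j) = (\<lambda>_. axis i 1 $ j)"
    by (rule ext, subst has_derivative_pderiv_dir[OF *]) simp
  then show ?case using * by (auto simp: smooth_closure.const differentiable_def)
next
  case (add f g)
  have *: "((\<lambda>x. f x + g x) has_derivative (\<lambda>v. grad f x \<bullet> v + grad g x \<bullet> v)) (at x)" for x
    by (intro has_derivative_add has_derivative_grad) (use add in auto)
  have "pderiv_dir i (\<lambda>x. f x + g x) = (\<lambda>x. pderiv_dir i f x + pderiv_dir i g x)"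
    by (rule ext, subst has_derivative_pderiv_dir[OF *])
       (simp add: grad_def inner_axis)
  moreover have "(\<lambda>x. pderiv_dir i f x + pderiv_dir i g x) \<in> smooth_closure"
    using add by (intro smooth_closure.add) auto
  ultimately show ?case using * by (auto simp: differentiable_def)
next
  case (mult f g)
  have *: "((\<lambda>x. f x * g x) has_derivative (\<lambda>v. f x * (grad g x \<bullet> v) + (grad f x \<bullet> v) * g x)) (at x)" for x
    by (intro has_derivative_mult has_derivative_grad) (use mult in auto)
  have "pderiv_dir i (\<lambda>x. f x * g x) = (\<lambda>x. f x * pderiv_dir i g x + pderiv_dir i f x * g x)"
    by (rule ext, subst has_derivative_pderiv_dir[OF *])
       (simp add: grad_def inner_axis)
  moreover have "(\<lambda>x. f x * pderiv_dir i g x + pderiv_dir i f x * g x) \<in> smooth_closure"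
    using mult by (intro smooth_closure.add smooth_closure.mult) auto
  ultimately show ?case using * by (auto simp: differentiable_def)
next
  case (flat f n)
  have *: "((\<lambda>x. flat n (f x)) has_derivative
      (\<lambda>v. (grad f x \<bullet> v) * (flat (n + 2) (f x) - real n * flat (n + 1) (f x)))) (at x)" for x
    by (rule has_derivative_eq_rhs[OF DERIV_compose_FDERIV[OF flat_has_real_derivative has_derivative_grad]])
       (use flat in auto)
  have "pderiv_dir i (\<lambda>x. flat n (f x)) =
      (\<lambda>x. pderiv_dir i f x * (flat (n + 2) (f x) + (- real n) * flat (n + 1) (f x)))"
    by (rule ext, subst has_derivative_pderiv_dir[OF *])
       (simp add: grad_def inner_axis)
  moreover have "(\<lambda>x. pderiv_dir i f x * (flat (n + 2) (f x) + (- real n) * flat (n + 1) (f x))) \<in> smooth_closure"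
    using flat by (intro smooth_closure.add smooth_closure.mult smooth_closure.const smooth_closure.flat) auto
  ultimately show ?case using * by (auto simp: differentiable_def)
qed

lemma smooth_closure_eq: "smooth_closure = {f. smooth_on f UNIV}"
  by (auto intro: smooth_closure.base smooth_on_invariant_set smooth_closure_derivative[THEN conjunct1]
      smooth_closure_derivative[THEN conjunct2])

lemma smooth_on_const: "smooth_on (\<lambda>_. c) UNIV"
  and smooth_on_coord: "smooth_on (\<lambda>x. x $ i) UNIV"
  and smooth_on_add: "smooth_on f UNIV \<Longrightarrow> smooth_on g UNIV \<Longrightarrow> smooth_on (\<lambda>x. f x + g x) UNIV"
  and smooth_on_mult: "smooth_on f UNIV \<Longrightarrow> smooth_on g UNIV \<Longrightarrow> smooth_on (\<lambda>x. f x * g x) UNIV"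
  and smooth_on_flat: "smooth_on f UNIV \<Longrightarrow> smooth_on (\<lambda>x. flat n (f x)) UNIV"
  using smooth_closure.const smooth_closure.coord smooth_closure.add smooth_closure.mult smooth_closure.flat
  unfolding smooth_closure_eq by blast+

lemma smooth_on_sum:
  "finite I \<Longrightarrow> (\<And>i. i \<in> I \<Longrightarrow> smooth_on (f i) UNIV) \<Longrightarrow> smooth_on (\<lambda>x. \<Sum>i\<in>I. f i x) UNIV"
  by (induction I rule: finite_induct) (auto intro: smooth_on_const smooth_on_add)

lemma continuous_on_grad:
  assumes "smooth_on f UNIV"
  shows "continuous_on UNIV (grad f)"
  unfolding grad_def
  by (intro continuous_on_vec_lambda continuous_at_imp_continuous_on ballI
      differentiable_imp_continuous_within smooth_on_differentiable smooth_on_pderiv_dir assms)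

lemma smooth_on_continuous: "smooth_on f UNIV \<Longrightarrow> continuous_on S f"
  by (intro continuous_at_imp_continuous_on ballI differentiable_imp_continuous_within
      smooth_on_differentiable)

section \<open>Square integrable functions\<close>

definition l2 :: "'a measure \<Rightarrow> ('a \<Rightarrow> 'b::euclidean_space) \<Rightarrow> bool" where
  "l2 M F \<longleftrightarrow> F \<in> borel_measurable M \<and> integrable M (\<lambda>x. (norm (F x))\<^sup>2)"

text \<open>Squared norms are kept throughout because energy and strong convexity are quadratic; the
  price is the factor 2 in \<open>sqn_triangle\<close>.\<close>

definition sqn :: "'a measure \<Rightarrow> ('a \<Rightarrow> 'b::euclidean_space) \<Rightarrow> real" where
  "sqn M F = (\<integral>x. (norm (F x))\<^sup>2 \<partial>M)"

lemma l2_measurable [measurable_dest]: "l2 M F \<Longrightarrow> F \<in> borel_measurable M"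
  and l2_integrable: "l2 M F \<Longrightarrow> integrable M (\<lambda>x. (norm (F x))\<^sup>2)"
  by (auto simp: l2_def)

lemma sqn_nonneg: "0 \<le> sqn M F"
  by (simp add: sqn_def)

lemma sqn_commute: "sqn M (\<lambda>x. F x - G x) = sqn M (\<lambda>x. G x - F x)"
  by (simp add: sqn_def norm_minus_commute)

lemma norm_add_sq_le:
  fixes a b :: "'b::real_inner"
  shows "(norm (a + b))\<^sup>2 \<le> 2 * (norm a)\<^sup>2 + 2 * (norm b)\<^sup>2"
  using zero_le_power2[of "norm (a - b)"]
  by (simp add: power2_norm_eq_inner algebra_simps inner_commute)

text \<open>The subtracted term is the exact strong convexity of the Dirichlet integral; it controls
  the distance of gradients in \<open>J_midpoint\<close>.\<close>

lemma midpoint_parallelogram: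
  fixes a b :: "'b::real_inner"
  shows "(norm ((1/2) *\<^sub>R a + (1/2) *\<^sub>R b))\<^sup>2 = ((norm a)\<^sup>2 + (norm b)\<^sup>2) / 2 - (norm (a - b))\<^sup>2 / 4"
  by (simp add: power2_norm_eq_inner inner_commute algebra_simps) (simp add: field_simps)

lemma l2_bound:
  assumes "l2 M G" "F \<in> borel_measurable M" "AE x in M. norm (F x) \<le> norm (G x)"
  shows "l2 M F" "sqn M F \<le> sqn M G"
proof -
  have F[measurable]: "F \<in> borel_measurable M" by fact
  have ae: "AE x in M. (norm (F x))\<^sup>2 \<le> (norm (G x))\<^sup>2"
    using assms(3) by eventually_elim (simp add: power_mono)
  show l: "l2 M F" unfolding l2_def
  proof
    show "integrable M (\<lambda>x. (norm (F x))\<^sup>2)"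
      by (rule Bochner_Integration.integrable_bound[OF l2_integrable[OF assms(1)]])
         (use ae in auto)
  qed fact
  show "sqn M F \<le> sqn M G" unfolding sqn_def
    by (rule integral_mono_AE) (use ae assms(1) l l2_integrable in auto)
qed

lemma l2_add:
  assumes "l2 M F" "l2 M G"
  shows "l2 M (\<lambda>x. F x + G x)" "sqn M (\<lambda>x. F x + G x) \<le> 2 * sqn M F + 2 * sqn M G"
proof -
  have [measurable]: "F \<in> borel_measurable M" "G \<in> borel_measurable M"
    using assms by (auto simp: l2_def)
  have i: "integrable M (\<lambda>x. 2 * (norm (F x))\<^sup>2 + 2 * (norm (G x))\<^sup>2)"
    using assms by (auto simp: l2_def)
  show l: "l2 M (\<lambda>x. F x + G x)" unfolding l2_def
  proof
    show "integrable M (\<lambda>x. (norm (F x + G x))\<^sup>2)"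
      by (rule Bochner_Integration.integrable_bound[OF i]) (auto intro: norm_add_sq_le)
  qed simp
  have "sqn M (\<lambda>x. F x + G x) \<le> (\<integral>x. 2 * (norm (F x))\<^sup>2 + 2 * (norm (G x))\<^sup>2 \<partial>M)"
    unfolding sqn_def by (rule integral_mono[OF l2_integrable[OF l] i norm_add_sq_le])
  also have "\<dots> = 2 * sqn M F + 2 * sqn M G"
    using assms by (simp add: sqn_def l2_def)
  finally show "sqn M (\<lambda>x. F x + G x) \<le> 2 * sqn M F + 2 * sqn M G" .
qed

lemma l2_scaleR:
  assumes "l2 M F"
  shows "l2 M (\<lambda>x. c *\<^sub>R F x)" "sqn M (\<lambda>x. c *\<^sub>R F x) = c\<^sup>2 * sqn M F"
  using assms by (auto simp: l2_def sqn_def power_mult_distrib)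

lemma l2_diff:
  assumes "l2 M F" "l2 M G"
  shows "l2 M (\<lambda>x. F x - G x)" "sqn M (\<lambda>x. F x - G x) \<le> 2 * sqn M F + 2 * sqn M G"
  using l2_add[OF assms(1) l2_scaleR(1)[OF assms(2), of "-1"]]
    l2_scaleR(2)[OF assms(2), of "-1"] by auto

lemma sqn_triangle:
  assumes "l2 M F" "l2 M G" "l2 M H"
  shows "sqn M (\<lambda>x. F x - H x) \<le> 2 * sqn M (\<lambda>x. F x - G x) + 2 * sqn M (\<lambda>x. G x - H x)"
  using l2_add(2)[OF l2_diff(1)[OF assms(1,2)] l2_diff(1)[OF assms(2,3)]] by simp

lemma l2_bounded:
  assumes "finite_measure M" "F \<in> borel_measurable M" "AE x in M. norm (F x) \<le> C"
  shows "l2 M F"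
proof -
  interpret finite_measure M by fact
  have "l2 M (\<lambda>x. C)" by (simp add: l2_def)
  moreover have "AE x in M. norm (F x) \<le> norm C"
    using assms(3) by eventually_elim simp
  ultimately show ?thesis using l2_bound(1) assms(2) by blast
qed

lemma borel_measurable_components:
  fixes P :: "'a \<Rightarrow> 'b::euclidean_space \<times> 'c::euclidean_space"
  assumes "P \<in> borel_measurable M"
  shows "(\<lambda>x. fst (P x)) \<in> borel_measurable M" "(\<lambda>x. snd (P x)) \<in> borel_measurable M"
  by (auto intro!: borel_measurable_continuous_on[OF _ assms] continuous_intros)

lemma l2_components:
  fixes F :: "'a \<Rightarrow> 'b::euclidean_space \<times> 'c::euclidean_space"
  assumes "l2 M F"
  shows "l2 M (\<lambda>x. fst (F x))" "l2 M (\<lambda>x. snd (F x))"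
    "sqn M (\<lambda>x. fst (F x)) \<le> sqn M F" "sqn M (\<lambda>x. snd (F x)) \<le> sqn M F"
proof -
  note m = borel_measurable_components[OF l2_measurable[OF assms]]
  have "AE x in M. norm (fst (F x)) \<le> norm (F x)" "AE x in M. norm (snd (F x)) \<le> norm (F x)"
    by (auto simp: norm_prod_def)
  then show "l2 M (\<lambda>x. fst (F x))" "l2 M (\<lambda>x. snd (F x))"
    "sqn M (\<lambda>x. fst (F x)) \<le> sqn M F" "sqn M (\<lambda>x. snd (F x)) \<le> sqn M F"
    using l2_bound[OF assms m(1)] l2_bound[OF assms m(2)] by auto
qed

lemma l2_inner_integrable:
  assumes "l2 M F" "l2 M G"
  shows "integrable M (\<lambda>x. F x \<bullet> G x)"
proof (rule Bochner_Integration.integrable_bound)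
  show "integrable M (\<lambda>x. (norm (F x))\<^sup>2 + (norm (G x))\<^sup>2)"
    using assms by (auto simp: l2_def)
  have "\<bar>a \<bullet> b\<bar> \<le> (norm a)\<^sup>2 + (norm b)\<^sup>2" for a b :: 'b
  proof -
    have "2 * (norm a * norm b) \<le> (norm a)\<^sup>2 + (norm b)\<^sup>2"
      using sum_squares_bound[of "norm a" "norm b"] by simp
    moreover have "0 \<le> norm a * norm b" by simp
    ultimately show ?thesis using Cauchy_Schwarz_ineq2[of a b] by linarith
  qed
  then show "AE x in M. norm (F x \<bullet> G x) \<le> norm ((norm (F x))\<^sup>2 + (norm (G x))\<^sup>2)"
    by auto
qed (use assms in \<open>auto simp: l2_def\<close>)

lemma l2_Cauchy_Schwarz:
  assumes "l2 M F" "l2 M G"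
  shows "(\<integral>x. F x \<bullet> G x \<partial>M)\<^sup>2 \<le> sqn M F * sqn M G"
proof -
  let ?I = "\<integral>x. F x \<bullet> G x \<partial>M"
  have *: "0 \<le> sqn M F - 2 * c * ?I + c\<^sup>2 * sqn M G" for c
  proof -
    have "0 \<le> (\<integral>x. (norm (F x - c *\<^sub>R G x))\<^sup>2 \<partial>M)" by simp
    also have "\<dots> = (\<integral>x. (norm (F x))\<^sup>2 - 2 * c * (F x \<bullet> G x) + c\<^sup>2 * (norm (G x))\<^sup>2 \<partial>M)"
      unfolding power2_norm_eq_inner
      by (simp add: algebra_simps inner_commute power2_eq_square)
    also have "\<dots> = sqn M F - 2 * c * ?I + c\<^sup>2 * sqn M G"
      using assms l2_inner_integrable[OF assms] by (simp add: l2_def sqn_def)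
    finally show ?thesis .
  qed
  show ?thesis
  proof (cases "sqn M G = 0")
    case True
    have "?I = 0"
    proof (rule ccontr)
      assume "?I \<noteq> 0"
      \<comment> \<open>For \<open>sqn M G = 0\<close> the lower bound is affine in
        \<open>c\<close>; this \<open>c\<close> gives it the value -1.\<close>
      then show False using *[of "(sqn M F + 1) / (2 * ?I)"] True by simp
    qed
    then show ?thesis using True by simp
  next
    case False
    then have "0 < sqn M G" using sqn_nonneg[of M G] by simp
    then show ?thesis using *[of "?I / sqn M G"]
      by (simp add: field_simps power2_eq_square)
  qed
qed

lemma l2_norm_integral:
  assumes "finite_measure M" "l2 M F"
  shows "integrable M (\<lambda>x. norm (F x))"
    and "(\<integral>x. norm (F x) \<partial>M)\<^sup>2 \<le> sqn M F * measure M (space M)"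
proof -
  interpret finite_measure M by fact
  have 1: "l2 M (\<lambda>x. 1::real)" by (simp add: l2_def)
  have 2: "l2 M (\<lambda>x. norm (F x))" using assms(2) by (auto simp: l2_def)
  show "integrable M (\<lambda>x. norm (F x))" using l2_inner_integrable[OF 2 1] by simp
  show "(\<integral>x. norm (F x) \<partial>M)\<^sup>2 \<le> sqn M F * measure M (space M)"
    using l2_Cauchy_Schwarz[OF 2 1] by (simp add: sqn_def)
qed

text \<open>Fatou's lemma for the squared norms. The bound is asked only eventually because the
  Cauchy property supplies it only for late indices.\<close>

lemma l2_Fatou:
  assumes "\<And>n. l2 M (F n)" "f \<in> borel_measurable M" "AE x in M. (\<lambda>n. F n x) \<longlonglongrightarrow> f x"
    and "\<forall>\<^sub>F n in sequentially. sqn M (F n) \<le> C"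
  shows "l2 M f" "sqn M f \<le> C"
proof -
  have [measurable]: "\<And>n. F n \<in> borel_measurable M" "f \<in> borel_measurable M"
    using assms by (auto simp: l2_def)
  have C: "0 \<le> C" using eventually_happens'[OF _ assms(4)] sqn_nonneg[of M] by (metis order_trans sequentially_bot)
  have "(\<integral>\<^sup>+x. ennreal ((norm (f x))\<^sup>2) \<partial>M) = (\<integral>\<^sup>+x. liminf (\<lambda>n. ennreal ((norm (F n x))\<^sup>2)) \<partial>M)"
  proof (rule nn_integral_cong_AE)
    show "AE x in M. ennreal ((norm (f x))\<^sup>2) = liminf (\<lambda>n. ennreal ((norm (F n x))\<^sup>2))"
      using assms(3)
    proof eventually_elim
      case (elim x)
      have "(\<lambda>n. ennreal ((norm (F n x))\<^sup>2)) \<longlonglongrightarrow> ennreal ((norm (f x))\<^sup>2)"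
        by (intro tendsto_intros elim)
      then show ?case by (rule lim_imp_Liminf[OF sequentially_bot, symmetric])
    qed
  qed
  also have "\<dots> \<le> liminf (\<lambda>n. \<integral>\<^sup>+x. ennreal ((norm (F n x))\<^sup>2) \<partial>M)"
    by (rule nn_integral_liminf) simp
  also have "\<dots> \<le> limsup (\<lambda>n. \<integral>\<^sup>+x. ennreal ((norm (F n x))\<^sup>2) \<partial>M)"
    by (rule Liminf_le_Limsup) simp
  also have "\<dots> \<le> ennreal C"
  proof (rule Limsup_bounded)
    show "\<forall>\<^sub>F n in sequentially. (\<integral>\<^sup>+x. ennreal ((norm (F n x))\<^sup>2) \<partial>M) \<le> ennreal C"
      using assms(4)
      by eventually_elim
         (subst nn_integral_eq_integral, auto simp: sqn_def l2_integrable[OF assms(1)] ennreal_leI)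
  qed
  finally have *: "(\<integral>\<^sup>+x. ennreal ((norm (f x))\<^sup>2) \<partial>M) \<le> ennreal C" .
  show l: "l2 M f" unfolding l2_def
    by (intro conjI assms integrableI_bounded)
       (simp_all add: le_less_trans[OF * ennreal_less_top])
  have "ennreal (sqn M f) \<le> ennreal C"
    using * by (subst (asm) nn_integral_eq_integral) (auto simp: sqn_def l2_integrable[OF l])
  then show "sqn M f \<le> C" using C by simp
qed

lemma AE_subseq_of_sqn:
  assumes "\<And>n. l2 M (F n)" "l2 M f" "(\<lambda>n. sqn M (\<lambda>x. F n x - f x)) \<longlonglongrightarrow> 0"
  obtains r where "strict_mono r" "AE x in M. (\<lambda>n. F (r n) x) \<longlonglongrightarrow> f x"
proof -
  have "\<exists>r. strict_mono r \<and> (AE x in M. (\<lambda>n. (norm (F (r n) x - f x))\<^sup>2) \<longlonglongrightarrow> 0)"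
    by (rule tendsto_L1_AE_subseq)
       (use assms(3) l2_integrable[OF l2_diff(1)[OF assms(1,2)]] in \<open>auto simp: sqn_def\<close>)
  then obtain r where r: "strict_mono r" "AE x in M. (\<lambda>n. (norm (F (r n) x - f x))\<^sup>2) \<longlonglongrightarrow> 0"
    by blast
  have "AE x in M. (\<lambda>n. F (r n) x) \<longlonglongrightarrow> f x"
    using r(2)
  proof eventually_elim
    case (elim x)
    then have "(\<lambda>n. sqrt ((norm (F (r n) x - f x))\<^sup>2)) \<longlonglongrightarrow> sqrt 0"
      by (intro tendsto_intros)
    then show ?case by (simp add: LIM_zero_iff tendsto_norm_zero_iff)
  qed
  with r(1) show ?thesis by (rule that)
qed

text \<open>The Riesz-Fischer argument: along a fast subsequence the increments have summable L1
  norms, since the measure is finite, so the subsequence converges a.e. Fatou then carries the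
  Cauchy estimate over to the difference between the original sequence and this limit.\<close>

lemma l2_complete:
  assumes fin: "finite_measure M" and l2: "\<And>n. l2 M (F n)"
    and cauchy: "\<And>e. e > 0 \<Longrightarrow> \<exists>N. \<forall>i\<ge>N. \<forall>j\<ge>N. sqn M (\<lambda>x. F i x - F j x) < e"
  obtains f where "l2 M f" "(\<lambda>n. sqn M (\<lambda>x. F n x - f x)) \<longlonglongrightarrow> 0"
proof -
  interpret finite_measure M by fact
  have [measurable]: "\<And>n. F n \<in> borel_measurable M" using l2 by (auto simp: l2_def)
  have "\<exists>N. \<forall>k. \<forall>i\<ge>N k. \<forall>j\<ge>N k. sqn M (\<lambda>x. F i x - F j x) < (1/4) ^ k"
    by (intro choice allI cauchy) simp
  then obtain N where N: "\<And>k i j. i \<ge> N k \<Longrightarrow> j \<ge> N k \<Longrightarrow> sqn M (\<lambda>x. F i x - F j x) < (1/4) ^ k"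
    by blast
  \<comment> \<open>The maximum makes the indices strictly increasing and at the same time puts
    \<open>r k\<close> beyond \<open>N k\<close>.\<close>
  define r where "r = rec_nat (N 0) (\<lambda>k y. max (Suc y) (N (Suc k)))"
  have rSuc: "r (Suc k) = max (Suc (r k)) (N (Suc k))" for k by (simp add: r_def)
  have mono: "strict_mono r" by (auto simp: strict_mono_Suc_iff rSuc)
  have rN: "N k \<le> r k" for k by (cases k) (auto simp: rSuc, simp add: r_def)
  define g where "g k x = F (r (Suc k)) x - F (r k) x" for k x
  have lg: "l2 M (g k)" for k unfolding g_def by (intro l2_diff l2)
  have "sqn M (g k) \<le> (1/4) ^ k" for k unfolding g_def
    using N[of k "r (Suc k)" "r k"] rN[of k] strict_monoD[OF mono, of k "Suc k"] by simp
  then have ng: "(\<integral>x. norm (g k x) \<partial>M) \<le> sqrt (measure M (space M)) * (1/2) ^ k" for k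
  proof -
    have "(\<integral>x. norm (g k x) \<partial>M)\<^sup>2 \<le> (1/4) ^ k * measure M (space M)"
      using l2_norm_integral(2)[OF fin lg, of k] \<open>sqn M (g k) \<le> (1/4) ^ k\<close>
      by (meson measure_nonneg mult_right_mono order_trans)
    then have "(\<integral>x. norm (g k x) \<partial>M) \<le> sqrt ((1/4) ^ k * measure M (space M))"
      by (rule real_le_rsqrt)
    also have "sqrt ((1/4) ^ k) = (1/2) ^ k"
      by (simp add: real_sqrt_power real_sqrt_divide)
    then have "sqrt ((1/4) ^ k * measure M (space M)) = sqrt (measure M (space M)) * (1/2) ^ k"
      by (simp add: real_sqrt_mult)
    finally show ?thesis .
  qed
  have [measurable]: "\<And>k. g k \<in> borel_measurable M" using lg by (auto simp: l2_def)
  have "(\<integral>\<^sup>+x. (\<Sum>k. ennreal (norm (g k x))) \<partial>M) = (\<Sum>k. \<integral>\<^sup>+x. ennreal (norm (g k x)) \<partial>M)"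
    by (rule nn_integral_suminf) simp
  also have "\<dots> \<le> (\<Sum>k. ennreal (sqrt (measure M (space M)) * (1/2) ^ k))"
    by (intro suminf_le summableI)
       (subst nn_integral_eq_integral, auto simp: l2_norm_integral(1)[OF fin lg] ng intro!: ennreal_leI)
  also have "\<dots> = ennreal (\<Sum>k. sqrt (measure M (space M)) * (1/2) ^ k)"
    by (rule suminf_ennreal2) (auto intro!: summable_mult summable_geometric)
  also have "\<dots> < \<infinity>" by simp
  finally have "AE x in M. (\<Sum>k. ennreal (norm (g k x))) \<noteq> \<infinity>"
    by (intro nn_integral_PInf_AE) auto
  then have conv: "AE x in M. convergent (\<lambda>n. F (r n) x)"
  proof eventually_elim
    case (elim x)
    then have "summable (\<lambda>k. norm (g k x))"
      by (intro summable_suminf_not_top) auto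
    then have "summable (\<lambda>k. g k x)" by (rule summable_norm_cancel)
    then have "convergent (\<lambda>n. F (r 0) x + (\<Sum>k<n. g k x))"
      by (intro convergent_add convergent_const) (simp add: summable_iff_convergent)
    also have "(\<lambda>n. F (r 0) x + (\<Sum>k<n. g k x)) = (\<lambda>n. F (r n) x)"
      unfolding g_def by (subst sum_lessThan_telescope[of "\<lambda>k. F (r k) x"]) simp
    finally show ?case .
  qed
  \<comment> \<open>On the null set where the subsequence diverges \<open>lim\<close> is some
    unspecified value, which harms neither measurability nor a.e. convergence.\<close>
  define f where "f x = lim (\<lambda>n. F (r n) x)" for x
  have [measurable]: "f \<in> borel_measurable M"
    unfolding f_def by (rule borel_measurable_lim_metric) simp
  have lim: "AE x in M. (\<lambda>n. F (r n) x) \<longlonglongrightarrow> f x"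
    using conv by eventually_elim (simp add: f_def convergent_LIMSEQ_iff)
  have close: "l2 M (\<lambda>x. F i x - f x) \<and> sqn M (\<lambda>x. F i x - f x) \<le> e"
    if N: "\<forall>i\<ge>K. \<forall>j\<ge>K. sqn M (\<lambda>x. F i x - F j x) < e" and "K \<le> i" for i K e
  proof -
    have "\<forall>\<^sub>F n in sequentially. sqn M (\<lambda>x. F i x - F (r n) x) \<le> e"
      using eventually_ge_at_top[of K]
    proof eventually_elim
      case (elim n)
      then have "K \<le> r n" using seq_suble[OF mono, of n] by simp
      then show ?case using N \<open>K \<le> i\<close> by (simp add: less_imp_le)
    qed
    moreover have "AE x in M. (\<lambda>n. F i x - F (r n) x) \<longlonglongrightarrow> F i x - f x"
      using lim by eventually_elim (intro tendsto_intros)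
    ultimately show ?thesis
      using l2_Fatou[of M "\<lambda>n x. F i x - F (r n) x" "\<lambda>x. F i x - f x" e, OF l2_diff(1)[OF l2 l2]]
      by auto
  qed
  obtain K where K: "\<forall>i\<ge>K. \<forall>j\<ge>K. sqn M (\<lambda>x. F i x - F j x) < 1" using cauchy[of 1] by auto
  have "l2 M f" using l2_diff(1)[OF l2[of K] conjunct1[OF close[OF K order_refl]]] by simp
  moreover have "(\<lambda>n. sqn M (\<lambda>x. F n x - f x)) \<longlonglongrightarrow> 0"
  proof (rule LIMSEQ_I)
    fix e :: real assume "e > 0"
    then obtain K where K: "\<forall>i\<ge>K. \<forall>j\<ge>K. sqn M (\<lambda>x. F i x - F j x) < e / 2"
      using cauchy[of "e / 2"] by auto
    show "\<exists>K. \<forall>n\<ge>K. norm (sqn M (\<lambda>x. F n x - f x) - 0) < e"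
    proof (intro exI allI impI)
      fix n assume "K \<le> n"
      then show "norm (sqn M (\<lambda>x. F n x - f x) - 0) < e"
        using close[OF K, of n] \<open>e > 0\<close> sqn_nonneg[of M "\<lambda>x. F n x - f x"] by auto
    qed
  qed
  ultimately show ?thesis by (rule that)
qed

section \<open>The space of weakly differentiable functions\<close>

definition pos_smooth :: "real \<Rightarrow> real \<Rightarrow> real" where
  "pos_smooth m t = t * flat 0 (m * t)"

text \<open>For s > 0 this is (1 + 1/s) exp(-1/s), the derivative of s exp(-1/s). By scaling, the
  derivative of \<open>pos_smooth m\<close> at t depends on \<open>m * t\<close> alone; it lies in
  [0,1] because 1 + y never exceeds exp y.\<close>

definition heaviside_smooth :: "real \<Rightarrow> real" where
  "heaviside_smooth s = flat 0 s + flat 1 s"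

lemma pos_smooth_has_real_derivative:
  "(pos_smooth m has_real_derivative heaviside_smooth (m * t)) (at t)"
proof -
  have 1: "((\<lambda>t. m * t) has_real_derivative m) (at t)"
    by (auto intro!: derivative_eq_intros)
  have "((\<lambda>t. flat 0 (m * t)) has_real_derivative (flat 2 (m * t) * m)) (at t)"
    using DERIV_chain2[OF flat_has_real_derivative[of 0 "m * t"] 1] by (simp add: numeral_2_eq_2)
  then have "((\<lambda>t. t * flat 0 (m * t)) has_real_derivative
      (flat 0 (m * t) + t * (flat 2 (m * t) * m))) (at t)"
    by (auto intro!: derivative_eq_intros)
  moreover have "t * (flat 2 (m * t) * m) = flat 1 (m * t)"
    by (auto simp: flat_def power2_eq_square field_simps)
  ultimately show ?thesis by (simp add: pos_smooth_def[abs_def] heaviside_smooth_def)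
qed

lemma heaviside_smooth_bounds: "0 \<le> heaviside_smooth s" "heaviside_smooth s \<le> 1"
proof -
  show "0 \<le> heaviside_smooth s" by (simp add: heaviside_smooth_def flat_nonneg)
  show "heaviside_smooth s \<le> 1"
  proof (cases "s > 0")
    case True
    have "1 + 1 / s \<le> exp (1 / s)" by (rule exp_ge_add_one_self)
    then show ?thesis using True
      by (simp add: heaviside_smooth_def flat_def exp_minus field_simps)
  qed (simp add: heaviside_smooth_def flat_def)
qed

lemma continuous_on_flat: "continuous_on S (flat n)"
  by (meson DERIV_isCont continuous_at_imp_continuous_on flat_has_real_derivative)

lemma borel_measurable_flat [measurable]: "flat n \<in> borel_measurable borel"
  by (rule borel_measurable_continuous_onI[OF continuous_on_flat])

lemma borel_measurable_pos_smooth [measurable]: "pos_smooth m \<in> borel_measurable borel"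
  and borel_measurable_heaviside_smooth [measurable]: "heaviside_smooth \<in> borel_measurable borel"
  unfolding pos_smooth_def[abs_def] heaviside_smooth_def[abs_def] by measurable

lemma isCont_heaviside_smooth: "isCont heaviside_smooth s"
  unfolding heaviside_smooth_def[abs_def]
  by (intro continuous_intros DERIV_isCont[OF flat_has_real_derivative])

lemma pos_smooth_lipschitz: "\<bar>pos_smooth m s - pos_smooth m t\<bar> \<le> \<bar>s - t\<bar>"
proof -
  have "norm (pos_smooth m s - pos_smooth m t) \<le> 1 * norm (s - t)"
    by (rule field_differentiable_bound[of UNIV])
       (use pos_smooth_has_real_derivative heaviside_smooth_bounds in \<open>auto simp: abs_of_nonneg\<close>)
  then show ?thesis by simp
qed

lemma flat_at_top:
  assumes "t > 0"
  shows "(\<lambda>k. flat n (real (Suc k) * t)) \<longlonglongrightarrow> (if n = 0 then 1 else 0)"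
proof -
  have 1: "(\<lambda>k. inverse (real (Suc k)) * (1 / t)) \<longlonglongrightarrow> 0"
    by (rule tendsto_mult_left_zero[OF LIMSEQ_inverse_real_of_nat])
  have "(\<lambda>k. exp (- (inverse (real (Suc k)) * (1 / t))) * (inverse (real (Suc k)) * (1 / t)) ^ n)
      \<longlonglongrightarrow> exp (- 0) * 0 ^ n"
    by (intro tendsto_intros 1)
  moreover have "flat n (real (Suc k) * t) =
      exp (- (inverse (real (Suc k)) * (1 / t))) * (inverse (real (Suc k)) * (1 / t)) ^ n" for k
  proof -
    have "0 < real (Suc k) * t" using assms by simp
    then have "flat n (real (Suc k) * t) = exp (- 1 / (real (Suc k) * t)) / (real (Suc k) * t) ^ n"
      by (simp add: flat_def del: of_nat_Suc)
    then show ?thesis by (simp add: divide_simps power_mult_distrib power_divide del: of_nat_Suc)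
  qed
  ultimately show ?thesis by (simp add: power_0_left)
qed

text \<open>All approximants vanish at t = 0, so the limit is the indicator of the strict
  inequality. This is why truncations carry the gradient 0 on the contact set.\<close>

lemma heaviside_smooth_limit:
  "(\<lambda>k. heaviside_smooth (real (Suc k) * t)) \<longlonglongrightarrow> (if t > 0 then 1 else 0)"
proof (cases "t > 0")
  case True
  then show ?thesis
    using tendsto_add[OF flat_at_top[OF True, of 0] flat_at_top[OF True, of 1]]
    by (simp add: heaviside_smooth_def)
next
  case False
  then show ?thesis by (simp add: heaviside_smooth_def flat_def zero_less_mult_iff)
qed

lemma pos_smooth_limit:
  "(\<lambda>k. pos_smooth (real (Suc k)) t) \<longlonglongrightarrow> (if t > 0 then t else 0)"
proof (cases "t > 0")
  case True
  then show ?thesis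
    using tendsto_mult_left[OF flat_at_top[OF True, of 0], of t]
    by (simp add: pos_smooth_def)
next
  case False
  then show ?thesis by (simp add: pos_smooth_def flat_def zero_less_mult_iff)
qed

lemma smooth_on_pos_smooth:
  assumes "smooth_on f UNIV"
  shows "smooth_on (\<lambda>x. pos_smooth m (f x)) UNIV"
  unfolding pos_smooth_def
  by (intro smooth_on_mult smooth_on_flat smooth_on_const assms)

text \<open>Value and gradient form one vector, so that the product norm is the pointwise H^1 norm
  and the Sobolev space can be handled as a closed subspace of an L2 space of pairs.\<close>

definition jet :: "(real^'n::finite \<Rightarrow> real) \<Rightarrow> real^'n \<Rightarrow> real \<times> (real^'n)" where
  "jet f x = (f x, grad f x)"

lemma jet_linear:
  assumes "smooth_on f UNIV" "smooth_on g UNIV"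
  shows "jet (\<lambda>x. a * f x + b * g x) x = a *\<^sub>R jet f x + b *\<^sub>R jet g x"
proof -
  have "((\<lambda>x. a * f x + b * g x) has_derivative
      (\<lambda>v. a * (grad f x \<bullet> v) + b * (grad g x \<bullet> v))) (at x)"
    by (intro has_derivative_add has_derivative_mult_right has_derivative_grad
        smooth_on_differentiable assms)
  then have "grad (\<lambda>x. a * f x + b * g x) x = a *\<^sub>R grad f x + b *\<^sub>R grad g x"
    by (intro grad_eqI) (simp add: inner_add_left)
  then show ?thesis by (simp add: jet_def)
qed

lemma jet_pos_smooth:
  assumes "smooth_on f UNIV"
  shows "jet (\<lambda>x. pos_smooth m (f x)) x = (pos_smooth m (f x), heaviside_smooth (m * f x) *\<^sub>R grad f x)"
proof -
  have "((\<lambda>x. pos_smooth m (f x)) has_derivative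
      (\<lambda>v. (grad f x \<bullet> v) * heaviside_smooth (m * f x))) (at x)"
    by (intro DERIV_compose_FDERIV[OF pos_smooth_has_real_derivative] has_derivative_grad
        smooth_on_differentiable assms)
  then show ?thesis
    unfolding jet_def by (intro arg_cong[of _ _ "Pair _"] grad_eqI) (simp add: mult.commute)
qed

lemma continuous_on_jet: "smooth_on f UNIV \<Longrightarrow> continuous_on UNIV (jet f)"
  unfolding jet_def[abs_def]
  by (intro continuous_on_Pair continuous_on_grad smooth_on_continuous)

section \<open>Test functions: support, boundedness and linear combinations\<close>

lemma test_funI:
  assumes "smooth_on f UNIV" "{x. f x \<noteq> 0} \<subseteq> C" "compact C" "C \<subseteq> \<Omega>"
  shows "test_fun \<Omega> f"
proof -
  have "closure {x. f x \<noteq> 0} \<subseteq> C"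
    using assms by (simp add: closure_minimal compact_imp_closed)
  moreover from this have "compact (closure {x. f x \<noteq> 0})"
    using assms(3) compact_closure bounded_subset compact_imp_bounded closure_subset by metis
  ultimately show ?thesis using assms by (auto simp: test_fun_def)
qed

lemma test_fun_support:
  assumes "test_fun \<Omega> f"
  obtains C where "compact C" "C \<subseteq> \<Omega>" "\<And>x. x \<notin> C \<Longrightarrow> f x = 0"
  using assms closure_subset[of "{x. f x \<noteq> 0}"] unfolding test_fun_def by blast

lemma test_fun_smooth: "test_fun \<Omega> f \<Longrightarrow> smooth_on f UNIV"
  by (simp add: test_fun_def)

lemma test_fun_bounded:
  assumes "test_fun \<Omega> \<phi>"
  obtains B where "B > 0" "\<And>x. \<bar>\<phi> x\<bar> \<le> B"
proof -
  obtain C where C: "compact C" "C \<subseteq> \<Omega>" "\<And>x. x \<notin> C \<Longrightarrow> \<phi> x = 0"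
    by (rule test_fun_support[OF assms]) blast
  have "bounded (\<phi> ` C)"
    by (intro compact_imp_bounded compact_continuous_image smooth_on_continuous test_fun_smooth[OF assms] C)
  then obtain B where B: "B > 0" "\<And>x. x \<in> C \<Longrightarrow> \<bar>\<phi> x\<bar> \<le> B"
    unfolding bounded_pos by auto
  have "\<bar>\<phi> x\<bar> \<le> B" for x using B C(3)[of x] by (cases "x \<in> C") auto
  then show ?thesis using B(1) that by blast
qed

lemma test_fun_linear:
  assumes "test_fun \<Omega> f" "test_fun \<Omega> g"
  shows "test_fun \<Omega> (\<lambda>x. a * f x + b * g x)"
proof -
  obtain C where C: "compact C" "C \<subseteq> \<Omega>" "\<And>x. x \<notin> C \<Longrightarrow> f x = 0"
    by (rule test_fun_support[OF assms(1)]) blast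
  obtain D where D: "compact D" "D \<subseteq> \<Omega>" "\<And>x. x \<notin> D \<Longrightarrow> g x = 0"
    by (rule test_fun_support[OF assms(2)]) blast
  show ?thesis
  proof (rule test_funI[of _ "C \<union> D"])
    show "smooth_on (\<lambda>x. a * f x + b * g x) UNIV"
      by (intro smooth_on_add smooth_on_mult smooth_on_const test_fun_smooth[OF assms(1)]
          test_fun_smooth[OF assms(2)])
    show "{x. a * f x + b * g x \<noteq> 0} \<subseteq> C \<union> D" using C(3) D(3) by force
  qed (use C D in auto)
qed

lemma test_fun_zero: "test_fun \<Omega> (\<lambda>_. 0)"
  by (rule test_funI[of _ "{}"]) (auto intro: smooth_on_const)

section \<open>The closure of the jets of test functions in L2\<close>

locale bounded_open_set =
  fixes \<Omega> :: "(real^'n::finite) set"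
  assumes open_\<Omega>: "open \<Omega>" and bounded_\<Omega>: "bounded \<Omega>"
begin

abbreviation M :: "(real^'n) measure" where "M \<equiv> lebesgue_on \<Omega>"

lemma \<Omega>_sets: "\<Omega> \<in> sets lebesgue"
  using open_\<Omega> by (simp add: borel_open)

lemma finite_M: "finite_measure M"
  by (intro finite_measure_lebesgue_on bounded_set_imp_lmeasurable bounded_\<Omega> \<Omega>_sets)

lemma l2_continuous:
  fixes f :: "real^'n \<Rightarrow> 'b::euclidean_space"
  assumes "continuous_on UNIV f"
  shows "l2 M f"
proof -
  have "bounded (f ` closure \<Omega>)"
    using bounded_\<Omega> assms
    by (intro compact_imp_bounded compact_continuous_image)
       (auto intro: continuous_on_subset simp: compact_closure)
  then obtain B where "\<And>x. x \<in> closure \<Omega> \<Longrightarrow> norm (f x) \<le> B"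
    unfolding bounded_iff by blast
  then have "AE x in M. norm (f x) \<le> B"
    using closure_subset[of \<Omega>] by (intro AE_I2) (auto simp: space_restrict_space)
  moreover have "f \<in> borel_measurable M"
    using assms \<Omega>_sets continuous_on_subset
    by (intro continuous_imp_measurable_on_sets_lebesgue) auto
  ultimately show ?thesis by (intro l2_bounded[OF finite_M])
qed

lemma l2_jet: "smooth_on f UNIV \<Longrightarrow> l2 M (jet f)"
  by (intro l2_continuous continuous_on_jet)

text \<open>Elements of \<open>H\<^sub>0\<^sup>1\<close> together with their weak gradient, as the L2 closure of the
  jets of test functions.\<close>

definition V :: "(real^'n \<Rightarrow> real \<times> (real^'n)) set" where
  "V = {F. l2 M F \<and> (\<forall>e>0. \<exists>f. test_fun \<Omega> f \<and> sqn M (\<lambda>x. F x - jet f x) < e)}"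

lemma V_l2: "F \<in> V \<Longrightarrow> l2 M F"
  by (simp add: V_def)

lemma V_approx:
  assumes "F \<in> V"
  obtains f where "\<And>k. test_fun \<Omega> (f k)" "(\<lambda>k. sqn M (\<lambda>x. jet (f k) x - F x)) \<longlonglongrightarrow> 0"
proof -
  have "\<exists>f. \<forall>k. test_fun \<Omega> (f k) \<and> sqn M (\<lambda>x. F x - jet (f k) x) < inverse (real (Suc k))"
    using assms by (intro choice allI) (auto simp: V_def)
  then obtain f where f: "\<And>k. test_fun \<Omega> (f k)"
      "\<And>k. sqn M (\<lambda>x. F x - jet (f k) x) < inverse (real (Suc k))"
    by blast
  have "(\<lambda>k. sqn M (\<lambda>x. F x - jet (f k) x)) \<longlonglongrightarrow> 0"
    by (rule tendsto_sandwich[OF _ _ tendsto_const LIMSEQ_inverse_real_of_nat])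
       (use f(2) less_imp_le sqn_nonneg in \<open>blast intro: always_eventually\<close>)+
  with f(1) show ?thesis using that[of f] unfolding sqn_commute[of M F] by blast
qed

lemma V_jet: "test_fun \<Omega> f \<Longrightarrow> jet f \<in> V"
  unfolding V_def by (auto intro: l2_jet test_fun_smooth simp: sqn_def intro!: exI[of _ f])

lemma V_zero: "(\<lambda>_. 0) \<in> V"
proof -
  have "jet (\<lambda>_. 0::real) = (\<lambda>_::real^'n. 0)"
    unfolding jet_def by (auto intro!: grad_eqI simp: zero_prod_def)
  then show ?thesis using V_jet[OF test_fun_zero] by simp
qed

lemma V_closed:
  assumes "\<And>k. F k \<in> V" "l2 M f" "(\<lambda>k. sqn M (\<lambda>x. F k x - f x)) \<longlonglongrightarrow> 0"
  shows "f \<in> V"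
  unfolding V_def
proof (safe)
  fix e :: real assume "e > 0"
  then obtain k where k: "sqn M (\<lambda>x. F k x - f x) < e / 4"
    using eventually_happens'[OF sequentially_bot order_tendstoD(2)[OF assms(3), of "e / 4"]] by auto
  obtain g where g: "test_fun \<Omega> g" "sqn M (\<lambda>x. F k x - jet g x) < e / 4"
    using assms(1)[of k] \<open>e > 0\<close> unfolding V_def by (auto dest!: spec[of _ "e / 4"])
  have "sqn M (\<lambda>x. f x - jet g x) \<le> 2 * sqn M (\<lambda>x. f x - F k x) + 2 * sqn M (\<lambda>x. F k x - jet g x)"
    by (intro sqn_triangle assms(2) V_l2[OF assms(1)] l2_jet[OF test_fun_smooth[OF g(1)]])
  also have "\<dots> < e" using k g(2) sqn_commute[of M f "F k"] by simp
  finally show "\<exists>g. test_fun \<Omega> g \<and> sqn M (\<lambda>x. f x - jet g x) < e" using g(1) by blast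
qed fact

lemma V_linear:
  assumes "F \<in> V" "G \<in> V"
  shows "(\<lambda>x. a *\<^sub>R F x + b *\<^sub>R G x) \<in> V"
proof -
  obtain f where f: "\<And>k. test_fun \<Omega> (f k)" "(\<lambda>k. sqn M (\<lambda>x. jet (f k) x - F x)) \<longlonglongrightarrow> 0"
    by (rule V_approx[OF assms(1)]) blast
  obtain g where g: "\<And>k. test_fun \<Omega> (g k)" "(\<lambda>k. sqn M (\<lambda>x. jet (g k) x - G x)) \<longlonglongrightarrow> 0"
    by (rule V_approx[OF assms(2)]) blast
  have lf: "l2 M (\<lambda>x. jet (f k) x - F x)" and lg: "l2 M (\<lambda>x. jet (g k) x - G x)" for k
    by (intro l2_diff l2_jet test_fun_smooth[OF f(1)] test_fun_smooth[OF g(1)] V_l2 assms)+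
  show ?thesis
  proof (rule V_closed)
    show "jet (\<lambda>x. a * f k x + b * g k x) \<in> V" for k
      by (intro V_jet test_fun_linear f g)
    show "l2 M (\<lambda>x. a *\<^sub>R F x + b *\<^sub>R G x)"
      by (intro l2_add l2_scaleR V_l2 assms)
    have eq: "jet (\<lambda>x. a * f k x + b * g k x) x - (a *\<^sub>R F x + b *\<^sub>R G x) =
        a *\<^sub>R (jet (f k) x - F x) + b *\<^sub>R (jet (g k) x - G x)" for k x
      using jet_linear[OF test_fun_smooth[OF f(1)] test_fun_smooth[OF g(1)]]
      by (simp add: algebra_simps)
    show "(\<lambda>k. sqn M (\<lambda>x. jet (\<lambda>x. a * f k x + b * g k x) x - (a *\<^sub>R F x + b *\<^sub>R G x))) \<longlonglongrightarrow> 0"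
    proof (rule tendsto_sandwich[OF _ _ tendsto_const])
      show "(\<lambda>k. 2 * (a\<^sup>2 * sqn M (\<lambda>x. jet (f k) x - F x)) + 2 * (b\<^sup>2 * sqn M (\<lambda>x. jet (g k) x - G x))) \<longlonglongrightarrow> 0"
        using f(2) g(2) by (auto intro!: tendsto_eq_intros)
      show "\<forall>\<^sub>F k in sequentially. sqn M (\<lambda>x. jet (\<lambda>x. a * f k x + b * g k x) x - (a *\<^sub>R F x + b *\<^sub>R G x))
        \<le> 2 * (a\<^sup>2 * sqn M (\<lambda>x. jet (f k) x - F x)) + 2 * (b\<^sup>2 * sqn M (\<lambda>x. jet (g k) x - G x))"
        unfolding eq using l2_add(2)[OF l2_scaleR(1)[OF lf] l2_scaleR(1)[OF lg]]
        by (auto intro!: always_eventually simp: l2_scaleR(2)[OF lf] l2_scaleR(2)[OF lg])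
    qed (simp add: sqn_nonneg)
  qed
qed

text \<open>The norm of a pair dominates the norms of its components, so the single limit of jets
  yields the two limits required for functions and gradients.\<close>

lemma V_H01:
  assumes "F \<in> V"
  shows "H01 \<Omega> (\<lambda>x. fst (F x)) (\<lambda>x. snd (F x))"
proof -
  obtain f where f: "\<And>k. test_fun \<Omega> (f k)" "(\<lambda>k. sqn M (\<lambda>x. jet (f k) x - F x)) \<longlonglongrightarrow> 0"
    by (rule V_approx[OF assms(1)]) blast
  note l = V_l2[OF assms]
  have lk: "l2 M (\<lambda>x. jet (f k) x - F x)" for k
    by (intro l2_diff l2_jet test_fun_smooth[OF f(1)] l)
  have 1: "(\<lambda>k. sqn M (\<lambda>x. fst (jet (f k) x - F x))) \<longlonglongrightarrow> 0"
    by (rule tendsto_sandwich[OF _ _ tendsto_const f(2)])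
       (use l2_components(3,4)[OF lk] sqn_nonneg in \<open>auto intro!: always_eventually\<close>)
  have 2: "(\<lambda>k. sqn M (\<lambda>x. snd (jet (f k) x - F x))) \<longlonglongrightarrow> 0"
    by (rule tendsto_sandwich[OF _ _ tendsto_const f(2)])
       (use l2_components(3,4)[OF lk] sqn_nonneg in \<open>auto intro!: always_eventually\<close>)
  have "(\<lambda>k. \<integral>x. (fst (F x) - f k x)\<^sup>2 \<partial>M) \<longlonglongrightarrow> 0"
    using 1 by (simp add: sqn_def jet_def power2_commute)
  moreover have "(\<lambda>k. \<integral>x. (norm (snd (F x) - grad (f k) x))\<^sup>2 \<partial>M) \<longlonglongrightarrow> 0"
    using 2 by (simp add: sqn_def jet_def norm_minus_commute)
  ultimately show ?thesis using l2_components(1,2)[OF l] f(1) unfolding H01_def l2_def by auto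
qed

text \<open>Positivity at every point will be reached by changing a representative on a null set;
  membership survives by closedness, applied to a constant sequence.\<close>

lemma V_cong_AE:
  assumes "F \<in> V" "l2 M G" "AE x in M. F x = G x"
  shows "G \<in> V"
proof (rule V_closed[of "\<lambda>_. F"])
  have "sqn M (\<lambda>x. F x - G x) = (\<integral>x. 0 \<partial>M)" unfolding sqn_def
    by (rule integral_cong_AE) (use assms(3) V_l2[OF assms(1)] assms(2) in \<open>auto simp: l2_def\<close>)
  then show "(\<lambda>k. sqn M (\<lambda>x. F x - G x)) \<longlonglongrightarrow> 0" by simp
qed (use assms in auto)

text \<open>\<open>P\<close> itself need not lie in \<open>V\<close>: the approximants only have to
  be positive inside a compact set, which contains the support after composition. The gradient error
  splits into the smooth Heaviside factor times the error of the gradients, at most the given error,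
  and the error of the factor times the fixed gradient \<open>snd (P x)\<close>.\<close>

lemma V_pos_smooth:
  assumes P: "l2 M P" and f: "\<And>k. smooth_on (f k) UNIV"
    and supp: "\<And>k. \<exists>C. compact C \<and> C \<subseteq> \<Omega> \<and> (\<forall>x. f k x > 0 \<longrightarrow> x \<in> C)"
    and lim: "(\<lambda>k. sqn M (\<lambda>x. jet (f k) x - P x)) \<longlonglongrightarrow> 0" and "m > 0"
  shows "(\<lambda>x. (pos_smooth m (fst (P x)), heaviside_smooth (m * fst (P x)) *\<^sub>R snd (P x))) \<in> V"
    (is "?Q \<in> V")
proof -
  note [measurable] = l2_measurable[OF P] borel_measurable_components[OF l2_measurable[OF P]]
  have lk: "l2 M (\<lambda>x. jet (f k) x - P x)" for k by (intro l2_diff l2_jet f P)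
  obtain r where r: "strict_mono r" "AE x in M. (\<lambda>k. jet (f (r k)) x) \<longlonglongrightarrow> P x"
    by (rule AE_subseq_of_sqn[of M "\<lambda>k. jet (f k)", OF l2_jet[OF f] P lim])
  define h where "h k = (\<lambda>x. pos_smooth m (f (r k) x))" for k
  have h: "test_fun \<Omega> (h k)" for k
  proof -
    obtain C where C: "compact C" "C \<subseteq> \<Omega>" "\<forall>x. f (r k) x > 0 \<longrightarrow> x \<in> C"
      using supp by blast
    have "{x. h k x \<noteq> 0} \<subseteq> C"
      using C(3) \<open>m > 0\<close> by (auto simp: h_def pos_smooth_def flat_def zero_less_mult_iff split: if_splits)
    then show ?thesis
      by (intro test_funI[OF _ _ C(1,2)]) (simp_all add: h_def smooth_on_pos_smooth f)
  qed
  \<comment> \<open>The square of the second part of the gradient error. It is dominated by the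
    integrable squared norm of \<open>snd (P x)\<close> and tends to 0 a.e. along the
    subsequence.\<close>
  define E where "E k x = (heaviside_smooth (m * f (r k) x) - heaviside_smooth (m * fst (P x)))\<^sup>2
      * (norm (snd (P x)))\<^sup>2" for k x
  have lQ: "l2 M ?Q"
  proof (rule l2_bound(1)[OF P])
    show "AE x in M. norm (?Q x) \<le> norm (P x)"
    proof (rule AE_I2)
      fix x
      have "\<bar>pos_smooth m (fst (P x))\<bar> \<le> \<bar>fst (P x)\<bar>"
        using pos_smooth_lipschitz[of m "fst (P x)" 0] by (simp add: pos_smooth_def)
      moreover have "norm (heaviside_smooth (m * fst (P x)) *\<^sub>R snd (P x)) \<le> norm (snd (P x))"
        using heaviside_smooth_bounds[of "m * fst (P x)"] by (simp add: mult_left_le_one_le)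
      ultimately show "norm (?Q x) \<le> norm (P x)"
        unfolding norm_prod_def by (auto intro!: add_mono power_mono simp: abs_le_square_iff)
    qed
  qed measurable
  have fm[measurable]: "f k \<in> borel_measurable M" for k
    using l2_continuous[OF smooth_on_continuous[OF f]] by (simp add: l2_def)
  have sP: "integrable M (\<lambda>x. (norm (snd (P x)))\<^sup>2)"
    by (rule Bochner_Integration.integrable_bound[OF l2_integrable[OF P]])
       (auto intro!: AE_I2 simp: norm_prod_def)
  have Eb: "0 \<le> E k x" "E k x \<le> (norm (snd (P x)))\<^sup>2" for k x
  proof -
    have "\<bar>heaviside_smooth (m * f (r k) x) - heaviside_smooth (m * fst (P x))\<bar> \<le> 1"
      using heaviside_smooth_bounds[of "m * f (r k) x"] heaviside_smooth_bounds[of "m * fst (P x)"]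
      by linarith
    then have "(heaviside_smooth (m * f (r k) x) - heaviside_smooth (m * fst (P x)))\<^sup>2 \<le> 1"
      by (simp add: abs_square_le_1)
    then show "E k x \<le> (norm (snd (P x)))\<^sup>2" unfolding E_def
      by (intro mult_left_le_one_le) auto
  qed (simp add: E_def)
  have Em[measurable]: "E k \<in> borel_measurable M" for k
    unfolding E_def[abs_def] by measurable
  have Ei: "integrable M (E k)" for k
    by (rule Bochner_Integration.integrable_bound[OF sP]) (use Eb in auto)
  have Elim: "(\<lambda>k. integral\<^sup>L M (E k)) \<longlonglongrightarrow> (\<integral>x. 0 \<partial>M)"
  proof (rule integral_dominated_convergence[OF _ _ sP])
    show "AE x in M. (\<lambda>k. E k x) \<longlonglongrightarrow> 0" using r(2)
    proof eventually_elim
      case (elim x)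
      have "(\<lambda>k. f (r k) x) \<longlonglongrightarrow> fst (P x)"
        using tendsto_fst[OF elim] by (simp add: jet_def)
      then have "(\<lambda>k. m * f (r k) x) \<longlonglongrightarrow> m * fst (P x)" by (intro tendsto_intros)
      then have "(\<lambda>k. heaviside_smooth (m * f (r k) x)) \<longlonglongrightarrow> heaviside_smooth (m * fst (P x))"
        by (rule isCont_tendsto_compose[OF isCont_heaviside_smooth])
      then show ?case unfolding E_def by (auto intro!: tendsto_eq_intros)
    qed
  qed (use Eb in auto)
  have bound: "(norm (jet (h k) x - ?Q x))\<^sup>2 \<le> 2 * (norm (jet (f (r k)) x - P x))\<^sup>2 + 2 * E k x" for k x
  proof -
    let ?b = "heaviside_smooth (m * f (r k) x)" and ?c = "heaviside_smooth (m * fst (P x))"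
    have "?b *\<^sub>R grad (f (r k)) x - ?c *\<^sub>R snd (P x) =
        ?b *\<^sub>R (grad (f (r k)) x - snd (P x)) + (?b - ?c) *\<^sub>R snd (P x)"
      by (simp add: algebra_simps)
    then have "(norm (?b *\<^sub>R grad (f (r k)) x - ?c *\<^sub>R snd (P x)))\<^sup>2 \<le>
        2 * (norm (?b *\<^sub>R (grad (f (r k)) x - snd (P x))))\<^sup>2 + 2 * (norm ((?b - ?c) *\<^sub>R snd (P x)))\<^sup>2"
      by (simp only: norm_add_sq_le)
    also have "(norm ((?b - ?c) *\<^sub>R snd (P x)))\<^sup>2 = E k x"
      by (simp add: E_def power_mult_distrib)
    also have "(norm (?b *\<^sub>R (grad (f (r k)) x - snd (P x))))\<^sup>2 \<le> (norm (grad (f (r k)) x - snd (P x)))\<^sup>2"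
      using heaviside_smooth_bounds by (intro power_mono) (auto simp: mult_left_le_one_le)
    finally have 1: "(norm (?b *\<^sub>R grad (f (r k)) x - ?c *\<^sub>R snd (P x)))\<^sup>2 \<le>
        2 * (norm (grad (f (r k)) x - snd (P x)))\<^sup>2 + 2 * E k x"
      by simp
    have 2: "(pos_smooth m (f (r k) x) - pos_smooth m (fst (P x)))\<^sup>2 \<le> (f (r k) x - fst (P x))\<^sup>2"
      using pos_smooth_lipschitz by (simp add: abs_le_square_iff)
    have sq: "(norm z)\<^sup>2 = (fst z)\<^sup>2 + (norm (snd z))\<^sup>2" for z :: "real \<times> (real^'n)"
      by (simp add: norm_prod_def)
    have arith: "A + B \<le> 2 * (c + d) + 2 * e" if "B \<le> 2 * d + 2 * e" "A \<le> c" "0 \<le> c" for A B c d e :: real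
      using that by simp
    show ?thesis
      unfolding h_def jet_pos_smooth[OF f] sq unfolding jet_def fst_diff snd_diff fst_conv snd_conv
      by (rule arith[OF 1 _ zero_le_power2]) (use 2 in simp)
  qed
  show ?thesis
  proof (rule V_closed[OF V_jet[OF h] lQ])
    have le: "sqn M (\<lambda>x. jet (h k) x - ?Q x) \<le> 2 * sqn M (\<lambda>x. jet (f (r k)) x - P x) + 2 * integral\<^sup>L M (E k)" for k
    proof -
      have "sqn M (\<lambda>x. jet (h k) x - ?Q x) \<le> (\<integral>x. 2 * (norm (jet (f (r k)) x - P x))\<^sup>2 + 2 * E k x \<partial>M)"
        unfolding sqn_def
        by (rule integral_mono[OF _ _ bound])
           (use Ei l2_integrable[OF lk] l2_integrable[OF l2_diff(1)[OF l2_jet[OF test_fun_smooth[OF h]] lQ]] in auto)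
      then show ?thesis using Ei l2_integrable[OF lk] by (simp add: sqn_def)
    qed
    have "(\<lambda>k. 2 * sqn M (\<lambda>x. jet (f (r k)) x - P x) + 2 * integral\<^sup>L M (E k)) \<longlonglongrightarrow> 0"
      using Elim LIMSEQ_subseq_LIMSEQ[OF lim r(1)]
      by (auto intro!: tendsto_eq_intros simp: o_def)
    then show "(\<lambda>k. sqn M (\<lambda>x. jet (h k) x - ?Q x)) \<longlonglongrightarrow> 0"
      by (rule Lim_null_comparison[rotated]) (use le in \<open>auto simp: sqn_nonneg\<close>)
  qed
qed

text \<open>This produces the competitors: with a = 1 and q = -1/2 the excess of u over 1/2, with a
  = -1 and q a paraboloid the amount by which u falls below it. Approximating u by test functions f,
  the function a f + q can be positive only on the union of the support of f with \<open>C\<close>,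
  so its smoothed positive part is again a test function. Then the smoothing parameter tends to
  infinity.\<close>

lemma V_positive_part:
  assumes F: "F \<in> V" and q: "smooth_on q UNIV"
    and C: "compact C" "C \<subseteq> \<Omega>" "\<And>x. q x > 0 \<Longrightarrow> x \<in> C"
  shows "(\<lambda>x. if a * fst (F x) + q x > 0 then (a * fst (F x) + q x, a *\<^sub>R snd (F x) + grad q x) else 0) \<in> V"
    (is "?R \<in> V")
proof -
  define P where "P = (\<lambda>x. a *\<^sub>R F x + 1 *\<^sub>R jet q x)"
  have P: "l2 M P" unfolding P_def by (intro l2_add l2_scaleR V_l2[OF F] l2_jet q)
  note [measurable] = l2_measurable[OF P] borel_measurable_components[OF l2_measurable[OF P]]
  obtain f where f: "\<And>k. test_fun \<Omega> (f k)" "(\<lambda>k. sqn M (\<lambda>x. jet (f k) x - F x)) \<longlonglongrightarrow> 0"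
    by (rule V_approx[OF F]) blast
  note fs = test_fun_smooth[OF f(1)]
  have Q: "(\<lambda>x. (pos_smooth m (fst (P x)), heaviside_smooth (m * fst (P x)) *\<^sub>R snd (P x))) \<in> V"
    if "m > 0" for m
  proof (rule V_pos_smooth[OF P _ _ _ that, of "\<lambda>k x. a * f k x + 1 * q x"])
    show "smooth_on (\<lambda>x. a * f k x + 1 * q x) UNIV" for k
      by (intro smooth_on_add smooth_on_mult smooth_on_const fs q)
    show "\<exists>C. compact C \<and> C \<subseteq> \<Omega> \<and> (\<forall>x. a * f k x + 1 * q x > 0 \<longrightarrow> x \<in> C)" for k
    proof -
      obtain D where D: "compact D" "D \<subseteq> \<Omega>" "\<And>x. x \<notin> D \<Longrightarrow> f k x = 0"
        by (rule test_fun_support[OF f(1)]) blast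
      have "x \<in> C \<union> D" if "a * f k x + 1 * q x > 0" for x
        using that D(3)[of x] C(3)[of x] by (cases "x \<in> D") auto
      then show ?thesis using C D by (intro exI[of _ "C \<union> D"]) auto
    qed
    have "jet (\<lambda>x. a * f k x + 1 * q x) x - P x = a *\<^sub>R (jet (f k) x - F x)" for k x
      unfolding jet_linear[OF fs q] P_def by (simp add: algebra_simps)
    then have "sqn M (\<lambda>x. jet (\<lambda>x. a * f k x + 1 * q x) x - P x) = a\<^sup>2 * sqn M (\<lambda>x. jet (f k) x - F x)" for k
      using l2_scaleR(2)[OF l2_diff(1)[OF l2_jet[OF fs] V_l2[OF F]], of a k] by simp
    then show "(\<lambda>k. sqn M (\<lambda>x. jet (\<lambda>x. a * f k x + 1 * q x) x - P x)) \<longlonglongrightarrow> 0"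
      using f(2) by (auto intro!: tendsto_eq_intros)
  qed
  have R: "?R = (\<lambda>x. if fst (P x) > 0 then P x else 0)"
    by (auto simp: P_def jet_def fun_eq_iff prod_eq_iff)
  have lR: "l2 M (\<lambda>x. if fst (P x) > 0 then P x else 0)"
    by (rule l2_bound(1)[OF P]) auto
  let ?Q = "\<lambda>k x. (pos_smooth (real (Suc k)) (fst (P x)), heaviside_smooth (real (Suc k) * fst (P x)) *\<^sub>R snd (P x))"
  let ?R = "\<lambda>x. if fst (P x) > 0 then P x else 0"
  have "(\<lambda>k. sqn M (\<lambda>x. ?Q k x - ?R x)) \<longlonglongrightarrow> (\<integral>x. 0 \<partial>M)"
    unfolding sqn_def
  proof (rule integral_dominated_convergence[OF _ _ l2_integrable[OF P]])
    show "AE x in M. (\<lambda>k. (norm (?Q k x - ?R x))\<^sup>2) \<longlonglongrightarrow> 0"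
    proof (rule AE_I2)
      fix x
      have "(\<lambda>k. ?Q k x) \<longlonglongrightarrow> (if fst (P x) > 0 then fst (P x) else 0, (if fst (P x) > 0 then 1 else 0) *\<^sub>R snd (P x))"
        by (intro tendsto_Pair tendsto_scaleR tendsto_const pos_smooth_limit heaviside_smooth_limit)
      also have "(if fst (P x) > 0 then fst (P x) else 0, (if fst (P x) > 0 then 1 else 0) *\<^sub>R snd (P x)) = ?R x"
        by (auto simp: zero_prod_def)
      finally have "(\<lambda>k. (norm (?Q k x - ?R x))\<^sup>2) \<longlonglongrightarrow> (norm (?R x - ?R x))\<^sup>2"
        by (intro tendsto_intros)
      then show "(\<lambda>k. (norm (?Q k x - ?R x))\<^sup>2) \<longlonglongrightarrow> 0" by simp
    qed
    show "AE x in M. norm ((norm (?Q k x - ?R x))\<^sup>2) \<le> (norm (P x))\<^sup>2" for k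
    proof (rule AE_I2)
      fix x
      let ?t = "fst (P x)"
      have f0: "flat n s = 0" if "s \<le> 0" for n s using that by (simp add: flat_def)
      have f1: "flat 0 s \<le> 1" for s by (simp add: flat_def)
      \<comment> \<open>Where \<open>fst (P x)\<close> is positive, each component of
        \<open>?Q k x\<close> is that of \<open>P x\<close> times a factor in [0,1]; elsewhere both
        terms vanish. Hence \<open>P\<close> dominates the error.\<close>
      have "norm (?Q k x - ?R x) \<le> norm (P x)"
      proof (cases "?t > 0")
        case False
        then have "real (Suc k) * ?t \<le> 0" by (simp add: mult_nonneg_nonpos)
        then have "?Q k x = 0"
          using f0[of "real (Suc k) * ?t"] by (simp add: pos_smooth_def heaviside_smooth_def zero_prod_def)
        then show ?thesis using False by simp
      next
        case True
        let ?s = "flat 0 (real (Suc k) * ?t)" and ?b = "heaviside_smooth (real (Suc k) * ?t)"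
        have "\<bar>?s * ?t - ?t\<bar> = \<bar>(1 - ?s)\<bar> * \<bar>?t\<bar>" by (simp add: algebra_simps flip: abs_mult)
        also have "\<dots> \<le> \<bar>?t\<bar>" using f1 flat_nonneg by (intro mult_left_le_one_le) auto
        finally have 1: "\<bar>?s * ?t - ?t\<bar> \<le> \<bar>?t\<bar>" .
        have "norm (?b *\<^sub>R snd (P x) - snd (P x)) = norm ((?b - 1) *\<^sub>R snd (P x))"
          by (simp add: algebra_simps)
        also have "\<dots> \<le> norm (snd (P x))"
          using heaviside_smooth_bounds[of "real (Suc k) * ?t"] by (simp add: mult_left_le_one_le)
        finally have 2: "norm (?b *\<^sub>R snd (P x) - snd (P x)) \<le> norm (snd (P x))" .
        have "?Q k x - ?R x = (?s * ?t - ?t, ?b *\<^sub>R snd (P x) - snd (P x))"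
          using True by (auto simp: pos_smooth_def prod_eq_iff)
        then show ?thesis using 1 2
          unfolding norm_prod_def by (auto intro!: add_mono power_mono simp: abs_le_square_iff)
      qed
      then show "norm ((norm (?Q k x - ?R x))\<^sup>2) \<le> (norm (P x))\<^sup>2"
        by (simp add: power_mono)
    qed
  qed auto
  then show ?thesis unfolding R using V_closed[OF Q lR, of "\<lambda>k. real (Suc k)"] by simp
qed

end

section \<open>Integration by parts against a paraboloid\<close>

lemma grad_eq_0_outside:
  assumes "closed C" "\<And>x. x \<notin> C \<Longrightarrow> f x = 0" "x \<notin> C"
  shows "grad f x = 0"
proof (rule grad_eqI)
  have "((\<lambda>x. 0) has_derivative (\<lambda>v. 0 \<bullet> v)) (at x)" by simp
  then show "(f has_derivative (\<lambda>v. 0 \<bullet> v)) (at x)"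
    by (rule has_derivative_transform_within_open[of _ _ _ _ "- C"]) (use assms in auto)
qed

lemma directional_quotient_limit:
  assumes "f differentiable (at x)"
  shows "(\<lambda>n. (f (x + inverse (real (Suc n)) *\<^sub>R v) - f x) * real (Suc n)) \<longlonglongrightarrow> grad f x \<bullet> v"
proof -
  have "((\<lambda>t. x + t *\<^sub>R v) has_derivative (\<lambda>t. t *\<^sub>R v)) (at 0)"
    by (auto intro!: derivative_eq_intros)
  moreover have "(f has_derivative (\<lambda>v. grad f x \<bullet> v)) (at (x + 0 *\<^sub>R v))"
    using has_derivative_grad[OF assms] by simp
  ultimately have "((\<lambda>t. f (x + t *\<^sub>R v)) has_derivative (\<lambda>t. grad f x \<bullet> (t *\<^sub>R v))) (at 0)"
    by (rule has_derivative_compose)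
  then have "((\<lambda>t. f (x + t *\<^sub>R v)) has_real_derivative grad f x \<bullet> v) (at 0)"
    by (simp add: has_field_derivative_def mult_commute_abs)
  then have lim: "((\<lambda>t. (f (x + t *\<^sub>R v) - f x) / t) \<longlongrightarrow> grad f x \<bullet> v) (at 0)"
    by (simp add: DERIV_def)
  have "filterlim (\<lambda>n. inverse (real (Suc n))) (at 0) sequentially"
    by (intro filterlim_atI LIMSEQ_inverse_real_of_nat) simp
  from filterlim_compose[OF lim this] show ?thesis by (simp add: divide_inverse)
qed

text \<open>Translation invariance of the Lebesgue measure, differentiated at 0.\<close>

lemma integral_pderiv_eq_0:
  assumes f: "smooth_on f UNIV" and C: "compact C" "\<And>x. x \<notin> C \<Longrightarrow> f x = 0"
  shows "integral\<^sup>L lborel (pderiv_dir i f) = 0"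
proof -
  let ?e = "axis i 1 :: real^'a"
  have fc: "continuous_on UNIV f" by (rule smooth_on_continuous[OF f])
  have [measurable]: "f \<in> borel_measurable borel" by (rule borel_measurable_continuous_onI[OF fc])
  have "bounded (grad f ` C)"
    using continuous_on_grad[OF f] C(1)
    by (intro compact_imp_bounded compact_continuous_image) (auto intro: continuous_on_subset)
  then obtain L where L: "0 < L" "\<And>x. x \<in> C \<Longrightarrow> norm (grad f x) \<le> L"
    unfolding bounded_pos by auto
  have L': "norm (grad f x) \<le> L" for x
    using L grad_eq_0_outside[OF compact_imp_closed[OF C(1)] C(2)] by (cases "x \<in> C") auto
  have lip: "norm (f x - f y) \<le> L * norm (x - y)" for x y
  proof (rule differentiable_bound[of UNIV f "\<lambda>x v. grad f x \<bullet> v"])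
    show "(f has_derivative (\<lambda>v. grad f x \<bullet> v)) (at x within UNIV)" for x
      using has_derivative_grad[OF smooth_on_differentiable[OF f]] by simp
    show "onorm (\<lambda>v. grad f x \<bullet> v) \<le> L" for x
    proof (rule onorm_bound)
      fix v
      show "norm (grad f x \<bullet> v) \<le> L * norm v"
        using Cauchy_Schwarz_ineq2[of "grad f x" v] mult_right_mono[OF L'[of x], of "norm v"] by simp
    qed (use L in simp)
  qed auto
  obtain R where "\<And>x. x \<in> C \<Longrightarrow> norm x \<le> R"
    using compact_imp_bounded[OF C(1)] unfolding bounded_iff by blast
  then have R: "C \<subseteq> cball 0 R" by auto
  have fi: "integrable lborel f"
  proof -
    have "integrable lborel (\<lambda>x. indicator C x *\<^sub>R f x)"
      by (rule borel_integrable_compact) (use C fc in \<open>auto intro: continuous_on_subset\<close>)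
    also have "(\<lambda>x. indicator C x *\<^sub>R f x) = f" using C(2) by (auto simp: indicator_def fun_eq_iff)
    finally show ?thesis .
  qed
  have shift: "integrable lborel (\<lambda>x. f (x + c)) \<and> (\<integral>x. f (x + c) \<partial>lborel) = integral\<^sup>L lborel f" for c
  proof -
    have "integrable (distr lborel borel ((+) c)) f" using fi by (simp add: lborel_distr_plus)
    then have 1: "integrable lborel (\<lambda>x. f (x + c))"
      by (subst (asm) integrable_distr_eq) (auto simp: add.commute)
    have "integral\<^sup>L lborel f = integral\<^sup>L (distr lborel borel ((+) c)) f" by (simp add: lborel_distr_plus)
    also have "\<dots> = (\<integral>x. f (x + c) \<partial>lborel)" by (subst integral_distr) (auto simp: add.commute)
    finally show ?thesis using 1 by simp
  qed
  define g where "g n x = (f (x + inverse (real (Suc n)) *\<^sub>R ?e) - f x) * real (Suc n)" for n x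
  have g0: "integral\<^sup>L lborel (g n) = 0" for n
    using shift[of "inverse (real (Suc n)) *\<^sub>R ?e"] fi unfolding g_def by simp
  have pd: "pderiv_dir i f x = grad f x \<bullet> ?e" for x by (simp add: grad_def inner_axis)
  have "(\<lambda>n. integral\<^sup>L lborel (g n)) \<longlonglongrightarrow> integral\<^sup>L lborel (pderiv_dir i f)"
  \<comment> \<open>The shifts have length at most 1, so every quotient vanishes outside the ball of
    radius \<open>R + 1\<close>, and it is bounded by the Lipschitz constant.\<close>
  proof (rule integral_dominated_convergence[where w = "\<lambda>x. indicator (cball 0 (R + 1)) x *\<^sub>R L"])
    show "pderiv_dir i f \<in> borel_measurable lborel"
      using smooth_on_continuous[OF smooth_on_pderiv_dir[OF f]]
      by (simp add: borel_measurable_continuous_onI)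
    show "g n \<in> borel_measurable lborel" for n unfolding g_def by measurable
    show "integrable lborel (\<lambda>x. indicator (cball 0 (R + 1)) x *\<^sub>R L :: real)"
      by (rule borel_integrable_compact) auto
    show "AE x in lborel. (\<lambda>n. g n x) \<longlonglongrightarrow> pderiv_dir i f x"
      unfolding g_def pd by (intro AE_I2 directional_quotient_limit smooth_on_differentiable f)
    show "AE x in lborel. norm (g n x) \<le> indicator (cball 0 (R + 1)) x *\<^sub>R L" for n
    proof (rule AE_I2)
      fix x :: "real^'a"
      let ?c = "inverse (real (Suc n)) *\<^sub>R ?e"
      have nc: "norm ?c = inverse (real (Suc n))" by (simp add: norm_eq_sqrt_inner inner_axis)
      show "norm (g n x) \<le> indicator (cball 0 (R + 1)) x *\<^sub>R L"
      proof (cases "x \<in> cball 0 (R + 1)")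
        case True
        have "\<bar>g n x\<bar> = \<bar>f (x + ?c) - f x\<bar> * real (Suc n)" unfolding g_def by (simp add: abs_mult)
        also have "\<dots> \<le> (L * inverse (real (Suc n))) * real (Suc n)"
          using lip[of "x + ?c" x] nc by (intro mult_right_mono) auto
        also have "(L * inverse (real (Suc n))) * real (Suc n) = L" by (simp del: of_nat_Suc)
        finally show ?thesis using True by simp
      next
        case False
        have "inverse (real (Suc n)) \<le> 1" by (simp add: inverse_le_1_iff)
        then have "norm x \<le> norm (x + ?c) + 1"
          using norm_triangle_ineq4[of "x + ?c" ?c] nc by simp
        then have "x + ?c \<notin> cball 0 R" "x \<notin> cball 0 R" using False by auto
        then have "f (x + ?c) = 0" "f x = 0" using R C(2) by blast+
        then show ?thesis using False by (simp add: g_def)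
      qed
    qed
  qed
  then show ?thesis using g0 by (simp add: LIMSEQ_const_iff)
qed

text \<open>A concave paraboloid whose negative Laplacian is the constant 2 N s. For s > 0 it is
  positive only inside the ball of radius R, so it enters the comparison only there.\<close>

definition barrier :: "real \<Rightarrow> real \<Rightarrow> real^'n::finite \<Rightarrow> real^'n \<Rightarrow> real" where
  "barrier s R a x = s * (R\<^sup>2 - (norm (x - a))\<^sup>2)"

lemma smooth_on_barrier: "smooth_on (barrier s R a) UNIV"
proof -
  have eq: "barrier s R a = (\<lambda>x. s * (R\<^sup>2 + (- 1) * (\<Sum>i\<in>UNIV. (x $ i + - a $ i) * (x $ i + - a $ i))))"
    by (auto simp: barrier_def power2_norm_eq_inner inner_vec_def fun_eq_iff)
  show ?thesis unfolding eq
    by (intro smooth_on_mult smooth_on_add smooth_on_const smooth_on_coord smooth_on_sum) auto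
qed

lemma grad_barrier: "grad (barrier s R a) x = (- 2 * s) *\<^sub>R (x - a)"
  unfolding barrier_def[abs_def] power2_norm_eq_inner
  by (intro grad_eqI) (auto intro!: derivative_eq_intros simp: inner_commute)

context bounded_open_set
begin

lemma l2_integrable_self:
  fixes F :: "real^'n \<Rightarrow> 'b::euclidean_space"
  shows "l2 M F \<Longrightarrow> integrable M F"
  using l2_norm_integral(1)[OF finite_M] integrable_norm_iff l2_measurable by blast

lemma integral_M_eq_lborel:
  fixes g :: "real^'n \<Rightarrow> real"
  assumes "continuous_on UNIV g" "\<And>x. x \<notin> \<Omega> \<Longrightarrow> g x = 0"
  shows "integral\<^sup>L M g = integral\<^sup>L lborel g"
proof -
  have "integral\<^sup>L M g = (\<integral>x. indicator \<Omega> x *\<^sub>R g x \<partial>lebesgue)"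
    using \<Omega>_sets by (intro integral_restrict_space) simp
  also have "(\<lambda>x. indicator \<Omega> x *\<^sub>R g x) = g" using assms(2) by (auto simp: indicator_def fun_eq_iff)
  also have "integral\<^sup>L lebesgue g = integral\<^sup>L lborel g"
    by (rule integral_completion) (simp add: borel_measurable_continuous_onI[OF assms(1)])
  finally show ?thesis .
qed

text \<open>The field (x - a) f has divergence N f + (x - a) . grad f, and each of its coordinates
  is a compactly supported smooth function whose partial derivative integrates to 0.\<close>

lemma integral_euler_field:
  assumes "test_fun \<Omega> f"
  shows "(\<integral>x. (x - a) \<bullet> grad f x \<partial>M) = - real CARD('n) * integral\<^sup>L M f"
proof -
  obtain C where C: "compact C" "C \<subseteq> \<Omega>" "\<And>x. x \<notin> C \<Longrightarrow> f x = 0"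
    by (rule test_fun_support[OF assms]) blast
  note f = test_fun_smooth[OF assms]
  define g where "g i x = (x $ i + - a $ i) * f x" for i x
  have gs: "smooth_on (g i) UNIV" for i
    unfolding g_def[abs_def] by (intro smooth_on_mult smooth_on_add smooth_on_const smooth_on_coord f)
  have g0: "g i x = 0" if "x \<notin> C" for i x using C(3)[OF that] by (simp add: g_def)
  have pg: "pderiv_dir i (g i) x = f x + (x $ i - a $ i) * pderiv_dir i f x" for i x
  proof -
    have "((\<lambda>x. x $ i + - a $ i) has_derivative (\<lambda>v. v $ i)) (at x)"
      by (auto intro!: derivative_eq_intros bounded_linear_imp_has_derivative bounded_linear_vec_nth)
    then have "(g i has_derivative (\<lambda>v. (x $ i + - a $ i) * (grad f x \<bullet> v) + v $ i * f x)) (at x)"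
      unfolding g_def[abs_def]
      by (intro has_derivative_mult has_derivative_grad smooth_on_differentiable f)
    from has_derivative_pderiv_dir[OF this] show ?thesis by (simp add: grad_def inner_axis)
  qed
  have int: "integral\<^sup>L M (pderiv_dir i (g i)) = 0" for i
  proof (subst integral_M_eq_lborel)
    show "continuous_on UNIV (pderiv_dir i (g i))"
      by (intro smooth_on_continuous smooth_on_pderiv_dir gs)
    show "pderiv_dir i (g i) x = 0" if "x \<notin> \<Omega>" for x
      using grad_eq_0_outside[of C "g i" x, OF compact_imp_closed[OF C(1)] g0] that C(2)
      by (auto simp: grad_def vec_eq_iff)
    show "integral\<^sup>L lborel (pderiv_dir i (g i)) = 0"
      by (rule integral_pderiv_eq_0[OF gs C(1) g0])
  qed
  have ig: "integrable M (pderiv_dir i (g i))" for i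
    by (intro l2_integrable_self l2_continuous smooth_on_continuous smooth_on_pderiv_dir gs)
  have i1: "integrable M f" by (intro l2_integrable_self l2_continuous smooth_on_continuous f)
  have i2: "integrable M (\<lambda>x. (x - a) \<bullet> grad f x)"
    by (intro l2_integrable_self l2_continuous continuous_intros continuous_on_grad f)
  have "(\<Sum>i\<in>UNIV. pderiv_dir i (g i) x) = real CARD('n) * f x + (x - a) \<bullet> grad f x" for x
    unfolding pg by (simp add: sum.distrib inner_vec_def grad_def)
  then have "(\<integral>x. real CARD('n) * f x + (x - a) \<bullet> grad f x \<partial>M) = (\<integral>x. (\<Sum>i\<in>UNIV. pderiv_dir i (g i) x) \<partial>M)"
    by simp
  also have "\<dots> = 0" using int ig by (subst Bochner_Integration.integral_sum) auto
  finally show ?thesis using i1 i2 by simp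
qed

text \<open>The weak form of: the negative Laplacian of the paraboloid is 2 N s. Its gradient is a
  multiple of x - a, so on test functions this is the identity for the Euler field; the passage to
  \<open>V\<close> uses only L2 continuity.\<close>

lemma barrier_integration_by_parts:
  assumes F: "F \<in> V"
  shows "(\<integral>x. grad (barrier s R a) x \<bullet> snd (F x) \<partial>M) = 2 * real CARD('n) * s * (\<integral>x. fst (F x) \<partial>M)"
proof -
  \<comment> \<open>Pairing with \<open>L\<close> is the difference of the two sides, so one
    application of Cauchy-Schwarz transfers its vanishing from jets to \<open>F\<close>.\<close>
  define L where "L x = (- (2 * real CARD('n) * s), grad (barrier s R a) x)" for x :: "real^'n"
  have lL: "l2 M L" unfolding L_def[abs_def]
    by (intro l2_continuous continuous_intros continuous_on_grad smooth_on_barrier)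
  obtain f where f: "\<And>k. test_fun \<Omega> (f k)" "(\<lambda>k. sqn M (\<lambda>x. jet (f k) x - F x)) \<longlonglongrightarrow> 0"
    by (rule V_approx[OF F]) blast
  note lj = l2_jet[OF test_fun_smooth[OF f(1)]]
  have int_eq: "(\<integral>x. L x \<bullet> P x \<partial>M) = (\<integral>x. grad (barrier s R a) x \<bullet> snd (P x) \<partial>M)
      - 2 * real CARD('n) * s * (\<integral>x. fst (P x) \<partial>M)" if P: "l2 M P" for P
  proof -
    have i1: "integrable M (\<lambda>x. fst (P x))"
      using l2_integrable_self[OF P] by (rule integrable_bounded_linear[OF bounded_linear_fst])
    have "integrable M (\<lambda>x. L x \<bullet> P x + 2 * real CARD('n) * s * fst (P x))"
      using l2_inner_integrable[OF lL P] i1 by auto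
    then have i2: "integrable M (\<lambda>x. grad (barrier s R a) x \<bullet> snd (P x))"
      by (simp add: L_def inner_prod_def)
    then show ?thesis using i1 i2 by (simp add: L_def inner_prod_def)
  qed
  have zero: "(\<integral>x. L x \<bullet> jet (f k) x \<partial>M) = 0" for k
    unfolding int_eq[OF lj] grad_barrier
    by (simp add: jet_def integral_euler_field[OF f(1)])
  have "(\<integral>x. L x \<bullet> F x \<partial>M)\<^sup>2 \<le> sqn M L * sqn M (\<lambda>x. jet (f k) x - F x)" for k
  proof -
    have "(\<integral>x. L x \<bullet> (jet (f k) x - F x) \<partial>M) = - (\<integral>x. L x \<bullet> F x \<partial>M)"
      unfolding inner_diff_right
      using zero l2_inner_integrable[OF lL lj] l2_inner_integrable[OF lL V_l2[OF F]] by simp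
    then show ?thesis using l2_Cauchy_Schwarz[OF lL l2_diff(1)[OF lj V_l2[OF F]], of k] by simp
  qed
  moreover have "(\<lambda>k. sqn M L * sqn M (\<lambda>x. jet (f k) x - F x)) \<longlonglongrightarrow> 0"
    using f(2) by (auto intro!: tendsto_eq_intros)
  ultimately have "(\<integral>x. L x \<bullet> F x \<partial>M)\<^sup>2 \<le> 0"
    by (intro LIMSEQ_le_const) auto
  then have "(\<integral>x. L x \<bullet> F x \<partial>M) = 0" by simp
  then show ?thesis using int_eq[OF V_l2[OF F]] by simp
qed

end

section \<open>The one-dimensional nonlinearity\<close>

definition hfun :: "real \<Rightarrow> real \<Rightarrow> real \<Rightarrow> real \<Rightarrow> real" where
  "hfun p r lam t = lam / 2 * t\<^sup>2 - t powr p / p - t powr (1 - r) / (1 - r)"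

text \<open>The derivative of \<open>hfun\<close> at positive arguments. At 0, where that slope is
  infinite, the convention for \<open>powr\<close> gives the value 0; later uses are at positive
  arguments or carry a factor that vanishes.\<close>

definition hder :: "real \<Rightarrow> real \<Rightarrow> real \<Rightarrow> real \<Rightarrow> real" where
  "hder p r lam t = lam * t - t powr (p - 1) - t powr (- r)"

lemma borel_measurable_hfun [measurable]: "hfun p r lam \<in> borel_measurable borel"
  unfolding hfun_def[abs_def] by measurable

text \<open>Differentiability is asked only inside (0,1), because the singular power has infinite
  slope at 0; continuity covers the endpoints.\<close>

lemma minimum_at_of_derivative_sign:
  fixes f f' :: "real \<Rightarrow> real"
  assumes cont: "continuous_on {0..1} f" and q: "0 \<le> q" "q \<le> 1" and u: "0 \<le> u" "u \<le> 1"
    and der: "\<And>t. 0 < t \<Longrightarrow> t < 1 \<Longrightarrow> (f has_real_derivative f' t) (at t)"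
    and left: "\<And>t. 0 < t \<Longrightarrow> t < q \<Longrightarrow> f' t \<le> 0"
    and right: "\<And>t. q < t \<Longrightarrow> t < 1 \<Longrightarrow> 0 \<le> f' t"
  shows "f q \<le> f u"
proof (cases "q \<le> u")
  case True
  have "continuous_on {q..u} f" using cont q u by (auto intro: continuous_on_subset)
  moreover have "\<exists>y. (f has_real_derivative y) (at t) \<and> 0 \<le> y" if "q < t" "t < u" for t
    using der[of t] right[of t] that q u by auto
  ultimately show ?thesis by (intro DERIV_nonneg_imp_increasing_open[OF True]) auto
next
  case False
  then have *: "u \<le> q" by simp
  have "continuous_on {u..q} f" using cont q u by (auto intro: continuous_on_subset)
  moreover have "\<exists>y. (f has_real_derivative y) (at t) \<and> y \<le> 0" if "u < t" "t < q" for t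
    using der[of t] left[of t] that q u by auto
  ultimately show ?thesis by (intro DERIV_nonpos_imp_decreasing_open[OF *]) auto
qed

lemma continuous_on_powr_nonneg:
  fixes s :: real
  assumes "0 < s" "S \<subseteq> {0..}"
  shows "continuous_on S (\<lambda>t. t powr s)"
  using assms by (intro continuous_on_powr' continuous_on_const continuous_on_id) auto

lemma powr_diff_le:
  fixes a b s :: real
  assumes "1 \<le> s" "0 < a" "a \<le> b" "b \<le> 1"
  shows "b powr s - a powr s \<le> s * (b - a)"
proof -
  have "(\<lambda>t. s * t - t powr s) a \<le> (\<lambda>t. s * t - t powr s) b"
  proof (rule DERIV_nonneg_imp_nondecreasing[OF \<open>a \<le> b\<close>])
    fix t assume t: "a \<le> t" "t \<le> b"
    have "((\<lambda>t. s * t - t powr s) has_real_derivative (s - s * t powr (s - 1))) (at t)"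
      using t assms by (auto intro!: derivative_eq_intros)
    moreover have "t powr (s - 1) \<le> 1" using t assms by (intro powr_le1) auto
    then have "0 \<le> s - s * t powr (s - 1)"
      using assms mult_left_le[of "t powr (s - 1)" s] by simp
    ultimately show "\<exists>y. ((\<lambda>t. s * t - t powr s) has_real_derivative y) (at t) \<and> 0 \<le> y" by blast
  qed
  then show ?thesis by (simp add: algebra_simps)
qed

text \<open>The second derivative (p - 1) t^(p-2) is at most p - 1 on (0,1]. Only first derivatives
  occur here: the derivative of the difference of the two sides changes sign at q, which is
  \<open>powr_diff_le\<close> for the exponent p - 1.\<close>

lemma powr_semiconcave:
  fixes p q u :: real
  assumes "2 \<le> p" "0 < q" "q \<le> 1" "0 \<le> u" "u \<le> 1"
  shows "u powr p / p \<le> q powr p / p + q powr (p - 1) * (u - q) + (p - 1) / 2 * (u - q)\<^sup>2"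
proof -
  let ?f = "\<lambda>u. q powr (p - 1) * (u - q) + (p - 1) / 2 * (u - q)\<^sup>2 - u powr p / p"
  let ?f' = "\<lambda>u. q powr (p - 1) + (p - 1) * (u - q) - u powr (p - 1)"
  have "?f q \<le> ?f u"
  proof (rule minimum_at_of_derivative_sign[where f = ?f and f' = ?f'])
    show "continuous_on {0..1} ?f"
      using assms
      by (intro continuous_on_diff continuous_on_add continuous_on_mult continuous_on_divide
          continuous_on_power continuous_on_powr_nonneg continuous_on_const continuous_on_id) auto
    show "(?f has_real_derivative ?f' t) (at t)" if "0 < t" "t < 1" for t
      using that assms by (auto intro!: derivative_eq_intros)
    show "?f' t \<le> 0" if "0 < t" "t < q" for t
      using powr_diff_le[of "p - 1" t q] that assms by (simp add: algebra_simps)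
    show "0 \<le> ?f' t" if "q < t" "t < 1" for t
      using powr_diff_le[of "p - 1" q t] that assms by (simp add: algebra_simps)
  qed (use assms in auto)
  then show ?thesis by simp
qed

lemma powr_concave_tangent:
  fixes r q u :: real
  assumes "0 < r" "r < 1" "0 < q" "q \<le> 1" "0 \<le> u" "u \<le> 1"
  shows "u powr (1 - r) / (1 - r) \<le> q powr (1 - r) / (1 - r) + q powr (- r) * (u - q)"
proof -
  let ?f = "\<lambda>u. q powr (- r) * (u - q) - u powr (1 - r) / (1 - r)"
  let ?f' = "\<lambda>u. q powr (- r) - u powr (- r)"
  have "?f q \<le> ?f u"
  proof (rule minimum_at_of_derivative_sign[where f = ?f and f' = ?f'])
    show "continuous_on {0..1} ?f"
      using assms
      by (intro continuous_on_diff continuous_on_add continuous_on_mult continuous_on_divide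
          continuous_on_power continuous_on_powr_nonneg continuous_on_const continuous_on_id) auto
    show "(?f has_real_derivative ?f' t) (at t)" if "0 < t" "t < 1" for t
      using that assms by (auto intro!: derivative_eq_intros)
    show "?f' t \<le> 0" if "0 < t" "t < q" for t
      using powr_mono2'[of "- r" t q] that assms by simp
    show "0 \<le> ?f' t" if "q < t" "t < 1" for t
      using powr_mono2'[of "- r" q t] that assms by simp
  qed (use assms in auto)
  then show ?thesis by simp
qed

text \<open>Of the coefficient lam/2 of the square, (p - 1)/2 compensates the power p; since lam is
  at least p, 1/2 is left. The base point q must be positive, whereas u may be 0, so in applications
  the base point is the function known to be positive.\<close>

lemma hfun_tangent:
  assumes "2 \<le> p" "0 < r" "r < 1" "p \<le> lam" "0 < q" "q \<le> 1" "0 \<le> u" "u \<le> 1"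
  shows "hfun p r lam q + hder p r lam q * (u - q) + (u - q)\<^sup>2 / 2 \<le> hfun p r lam u"
proof -
  have 1: "lam / 2 * u\<^sup>2 = lam / 2 * q\<^sup>2 + lam * q * (u - q) + lam / 2 * (u - q)\<^sup>2"
    by (simp add: power2_eq_square field_simps)
  have "1 / 2 * (u - q)\<^sup>2 \<le> (lam / 2 - (p - 1) / 2) * (u - q)\<^sup>2"
    by (rule mult_right_mono[OF _ zero_le_power2]) (use assms in \<open>simp add: field_simps\<close>)
  then have 2: "(u - q)\<^sup>2 / 2 + (p - 1) / 2 * (u - q)\<^sup>2 \<le> lam / 2 * (u - q)\<^sup>2"
    by (simp only: left_diff_distrib)
  have "hder p r lam q * (u - q) = lam * q * (u - q) - q powr (p - 1) * (u - q) - q powr (- r) * (u - q)"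
    by (simp add: hder_def algebra_simps)
  then show ?thesis
    using 1 2 powr_semiconcave[of p q u] powr_concave_tangent[of r q u] assms
    unfolding hfun_def by linarith
qed

text \<open>The tangent inequality at the midpoint is applied to both ends: the linear terms cancel
  and half of ((a - b)/2)^2 remains. The midpoint is 0 only if both ends are, which is the separate
  case.\<close>

lemma hfun_midpoint:
  assumes "2 \<le> p" "0 < r" "r < 1" "p \<le> lam" "0 \<le> a" "a \<le> 1" "0 \<le> b" "b \<le> 1"
  shows "hfun p r lam ((a + b) / 2) \<le> (hfun p r lam a + hfun p r lam b) / 2 - (a - b)\<^sup>2 / 8"
proof (cases "a + b = 0")
  case True
  then have "a = 0" "b = 0" using assms by auto
  then show ?thesis by simp
next
  case False
  let ?m = "(a + b) / 2"
  have m: "0 < ?m" "?m \<le> 1" using assms False by auto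
  have d: "a - ?m = (a - b) / 2" "b - ?m = - ((a - b) / 2)" by (auto simp: field_simps)
  have "hfun p r lam ?m + hder p r lam ?m * ((a - b) / 2) + ((a - b) / 2)\<^sup>2 / 2 \<le> hfun p r lam a"
    using hfun_tangent[OF assms(1-4) m, of a] assms unfolding d by simp
  moreover have "hfun p r lam ?m + hder p r lam ?m * (- ((a - b) / 2)) + ((a - b) / 2)\<^sup>2 / 2 \<le> hfun p r lam b"
    using hfun_tangent[OF assms(1-4) m, of b] assms unfolding d by simp
  moreover have "((a - b) / 2)\<^sup>2 = (a - b)\<^sup>2 / 4" by (simp add: power_divide)
  ultimately show ?thesis by (simp add: field_simps)
qed

text \<open>On [1/2, 1] the two powers in the derivative are at most 1 and 2, while lam x is at
  least 3: this is the origin of the threshold 6.\<close>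

lemma hfun_mono:
  assumes "2 \<le> p" "0 < r" "r < 1" "6 \<le> lam" "1 / 2 \<le> s" "s \<le> t" "t \<le> 1"
  shows "hfun p r lam s \<le> hfun p r lam t"
proof (rule DERIV_nonneg_imp_nondecreasing[OF \<open>s \<le> t\<close>])
  fix x assume x: "s \<le> x" "x \<le> t"
  have "(hfun p r lam has_real_derivative hder p r lam x) (at x)"
    unfolding hfun_def[abs_def] hder_def using x assms
    by (auto intro!: derivative_eq_intros)
  moreover have "x powr (p - 1) \<le> 1" using x assms by (intro powr_le1) auto
  moreover have "x powr (- r) \<le> (1 / 2) powr (- 1)"
  proof -
    have "x powr (- r) \<le> (1 / 2) powr (- r)" using x assms by (intro powr_mono2') auto
    also have "\<dots> \<le> (1 / 2) powr (- 1)" using assms by (intro powr_mono') auto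
    finally show ?thesis .
  qed
  moreover have "(1 / 2 :: real) powr (- 1) = 2" by (simp add: powr_minus)
  moreover have "6 * (1 / 2) \<le> lam * x" using x assms by (intro mult_mono) auto
  ultimately show "\<exists>y. (hfun p r lam has_real_derivative y) (at x) \<and> 0 \<le> y"
    unfolding hder_def by (intro exI[of _ "lam * x - x powr (p - 1) - x powr (- r)"]) auto
qed

section \<open>Bounds and continuity for integrability and dominated convergence\<close>

lemma hfun_bound:
  assumes "2 \<le> p" "0 < r" "r < 1" "0 \<le> t" "t \<le> 1"
  shows "\<bar>hfun p r lam t\<bar> \<le> \<bar>lam\<bar> + 1 + 1 / (1 - r)"
proof -
  have "t\<^sup>2 \<le> 1" using assms by (simp add: power_le_one)
  then have "\<bar>lam / 2 * t\<^sup>2\<bar> \<le> \<bar>lam\<bar> / 2 * 1"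
    unfolding abs_mult by (intro mult_mono) auto
  moreover have "t powr p / p \<le> 1"
    using powr_le1[of p t] assms by (simp add: divide_le_eq)
  moreover have "t powr (1 - r) / (1 - r) \<le> 1 / (1 - r)"
    using powr_le1[of "1 - r" t] assms by (simp add: divide_right_mono)
  moreover have "0 \<le> t powr p / p" "0 \<le> t powr (1 - r) / (1 - r)" using assms by auto
  ultimately show ?thesis unfolding hfun_def by auto
qed

lemma hfun_lam: "hfun p r lam t = hfun p r lam' t + (lam - lam') / 2 * t\<^sup>2"
  by (simp add: hfun_def algebra_simps diff_divide_distrib)

lemma borel_measurable_hder [measurable]: "hder p r lam \<in> borel_measurable borel"
  unfolding hder_def[abs_def] by measurable

lemma isCont_hder: "0 < t \<Longrightarrow> isCont (hder p r lam) t"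
  unfolding hder_def[abs_def] by (intro continuous_intros) auto

lemma hder_bound:
  assumes "2 \<le> p" "0 < r" "0 < e" "e \<le> t" "t \<le> 1"
  shows "\<bar>hder p r lam t\<bar> \<le> \<bar>lam\<bar> + 1 + e powr (- r)"
proof -
  have "\<bar>lam * t\<bar> \<le> \<bar>lam\<bar> * 1" unfolding abs_mult using assms by (intro mult_left_mono) auto
  moreover have "t powr (p - 1) \<le> 1" "0 \<le> t powr (p - 1)" using assms by (auto intro!: powr_le1)
  moreover have "t powr (- r) \<le> e powr (- r)" "0 \<le> t powr (- r)" using assms by (auto intro!: powr_mono2')
  ultimately show ?thesis unfolding hder_def by linarith
qed

lemma continuous_on_hfun:
  assumes "2 \<le> p" "0 < r" "r < 1"
  shows "continuous_on {0..} (hfun p r lam)"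
  unfolding hfun_def using assms
  by (intro continuous_on_diff continuous_on_mult continuous_on_divide
      continuous_on_power continuous_on_powr_nonneg continuous_on_const continuous_on_id) auto

section \<open>The constrained minimisation problem\<close>

locale singular_problem = bounded_open_set \<Omega> for \<Omega> :: "(real^'n::finite) set" +
  fixes p r :: real
  assumes p: "2 \<le> p" and r: "0 < r" "r < 1"
begin

definition K :: "(real^'n \<Rightarrow> real \<times> (real^'n)) set" where
  "K = {F \<in> V. AE x in M. 0 \<le> fst (F x) \<and> fst (F x) \<le> 1}"

definition density :: "real \<Rightarrow> real \<times> (real^'n) \<Rightarrow> real" where
  "density lam z = (norm (snd z))\<^sup>2 / 2 + hfun p r lam (fst z)"

definition J :: "real \<Rightarrow> (real^'n \<Rightarrow> real \<times> (real^'n)) \<Rightarrow> real" where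
  "J lam F = (\<integral>x. density lam (F x) \<partial>M)"

lemma K_V: "F \<in> K \<Longrightarrow> F \<in> V"
  and K_AE: "F \<in> K \<Longrightarrow> AE x in M. 0 \<le> fst (F x) \<and> fst (F x) \<le> 1"
  and K_l2: "F \<in> K \<Longrightarrow> l2 M F"
  by (auto simp: K_def V_l2)

lemma KI: "F \<in> V \<Longrightarrow> AE x in M. 0 \<le> fst (F x) \<and> fst (F x) \<le> 1 \<Longrightarrow> F \<in> K"
  by (simp add: K_def)

lemma integrable_hfun:
  assumes [measurable]: "u \<in> borel_measurable M" and "AE x in M. 0 \<le> u x \<and> u x \<le> 1"
  shows "integrable M (\<lambda>x. hfun p r lam (u x))"
proof (rule finite_measure.integrable_const_bound[OF finite_M])
  show "AE x in M. norm (hfun p r lam (u x)) \<le> \<bar>lam\<bar> + 1 + 1 / (1 - r)"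
    using assms(2) by eventually_elim (use hfun_bound[OF p r] in auto)
qed measurable

lemma K_integrable_hfun: "F \<in> K \<Longrightarrow> integrable M (\<lambda>x. hfun p r lam (fst (F x)))"
  using integrable_hfun[OF l2_measurable[OF l2_components(1)[OF K_l2]] K_AE] .

lemma integrable_snd: "l2 M F \<Longrightarrow> integrable M (\<lambda>x. (norm (snd (F x)))\<^sup>2)" for F :: "real^'n \<Rightarrow> real \<times> (real^'n)"
  by (rule l2_integrable[OF l2_components(2)])

lemma integrable_density: "F \<in> K \<Longrightarrow> integrable M (\<lambda>x. density lam (F x))"
  unfolding density_def using K_integrable_hfun integrable_snd[OF K_l2] by auto

lemma zero_K: "(\<lambda>_. 0) \<in> K"
  by (auto intro!: KI V_zero)

lemma J_zero: "J lam (\<lambda>_. 0) = 0"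
  by (simp add: J_def density_def hfun_def)

lemma J_lower: "F \<in> K \<Longrightarrow> - (\<bar>lam\<bar> + 1 + 1 / (1 - r)) * measure M (space M) \<le> J lam F"
proof -
  assume F: "F \<in> K"
  interpret finite_measure M by (rule finite_M)
  have "(\<integral>x. - (\<bar>lam\<bar> + 1 + 1 / (1 - r)) \<partial>M) \<le> J lam F"
    unfolding J_def
  proof (rule integral_mono_AE[OF _ integrable_density[OF F]])
    show "AE x in M. - (\<bar>lam\<bar> + 1 + 1 / (1 - r)) \<le> density lam (F x)"
      using K_AE[OF F]
    proof eventually_elim
      case (elim x)
      have "- (\<bar>lam\<bar> + 1 + 1 / (1 - r)) \<le> hfun p r lam (fst (F x))"
        using hfun_bound[OF p r, of "fst (F x)" lam] elim by (simp add: abs_le_iff)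
      moreover have "0 \<le> (norm (snd (F x)))\<^sup>2 / 2" by simp
      ultimately show ?case unfolding density_def by linarith
    qed
  qed simp
  then show ?thesis by (simp add: mult.commute)
qed

text \<open>Affine dependence on \<open>lam\<close> with slope half the mass. It turns energy
  comparisons between different multipliers into statements about masses.\<close>

lemma J_lam: "F \<in> K \<Longrightarrow> J lam F = J lam' F + (lam - lam') / 2 * (\<integral>x. (fst (F x))\<^sup>2 \<partial>M)"
proof -
  assume F: "F \<in> K"
  have i: "integrable M (\<lambda>x. (fst (F x))\<^sup>2)"
    using l2_integrable[OF l2_components(1)[OF K_l2[OF F]]] by simp
  have "density lam (F x) = density lam' (F x) + (lam - lam') / 2 * (fst (F x))\<^sup>2" for x
    using hfun_lam[of p r lam "fst (F x)" lam'] by (simp add: density_def)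
  then have "J lam F = (\<integral>x. density lam' (F x) + (lam - lam') / 2 * (fst (F x))\<^sup>2 \<partial>M)"
    by (simp add: J_def)
  also have "\<dots> = J lam' F + (lam - lam') / 2 * (\<integral>x. (fst (F x))\<^sup>2 \<partial>M)"
    unfolding J_def using integrable_density[OF F] i by (subst Bochner_Integration.integral_add) auto
  finally show ?thesis .
qed

text \<open>Gradient part and zero order part both contribute the defect 1/8, the former by the
  parallelogram identity, the latter by \<open>hfun_midpoint\<close>. Together they give the full
  squared H^1 distance, so no Poincare inequality enters.\<close>

lemma J_midpoint:
  assumes F: "F \<in> K" and G: "G \<in> K" and lam: "p \<le> lam"
  shows "(\<lambda>x. (1/2) *\<^sub>R F x + (1/2) *\<^sub>R G x) \<in> K" (is "?H \<in> K")
    and "J lam (\<lambda>x. (1/2) *\<^sub>R F x + (1/2) *\<^sub>R G x) \<le> (J lam F + J lam G) / 2 - sqn M (\<lambda>x. F x - G x) / 8"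
proof -
  show H: "?H \<in> K"
  proof (rule KI[OF V_linear[OF K_V[OF F] K_V[OF G]]])
    show "AE x in M. 0 \<le> fst (?H x) \<and> fst (?H x) \<le> 1"
      using K_AE[OF F] K_AE[OF G] by eventually_elim auto
  qed
  have il: "integrable M (\<lambda>x. (norm (F x - G x))\<^sup>2)"
    by (intro l2_integrable l2_diff K_l2 F G)
  have "J lam ?H \<le> (\<integral>x. (density lam (F x) + density lam (G x)) / 2 - (norm (F x - G x))\<^sup>2 / 8 \<partial>M)"
    unfolding J_def
  proof (rule integral_mono_AE[OF integrable_density[OF H]])
    show "integrable M (\<lambda>x. (density lam (F x) + density lam (G x)) / 2 - (norm (F x - G x))\<^sup>2 / 8)"
      using integrable_density[OF F] integrable_density[OF G] il by auto
    show "AE x in M. density lam (?H x) \<le> (density lam (F x) + density lam (G x)) / 2 - (norm (F x - G x))\<^sup>2 / 8"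
      using K_AE[OF F] K_AE[OF G]
    proof eventually_elim
      case (elim x)
      have "hfun p r lam (fst (?H x)) \<le>
          (hfun p r lam (fst (F x)) + hfun p r lam (fst (G x))) / 2 - (fst (F x) - fst (G x))\<^sup>2 / 8"
        using hfun_midpoint[OF p r lam, of "fst (F x)" "fst (G x)"] elim by (simp add: add_divide_distrib)
      moreover have "(norm (snd (?H x)))\<^sup>2 = ((norm (snd (F x)))\<^sup>2 + (norm (snd (G x)))\<^sup>2) / 2
          - (norm (snd (F x) - snd (G x)))\<^sup>2 / 4"
        by (simp add: midpoint_parallelogram)
      moreover have "(norm (F x - G x))\<^sup>2 = (fst (F x) - fst (G x))\<^sup>2 + (norm (snd (F x) - snd (G x)))\<^sup>2"
        by (simp add: norm_prod_def)
      ultimately show ?case unfolding density_def by (simp add: field_simps)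
    qed
  qed
  also have "\<dots> = (J lam F + J lam G) / 2 - sqn M (\<lambda>x. F x - G x) / 8"
    using integrable_density[OF F] integrable_density[OF G] il
    by (simp add: J_def sqn_def)
  finally show "J lam ?H \<le> (J lam F + J lam G) / 2 - sqn M (\<lambda>x. F x - G x) / 8" .
qed

text \<open>The Dirichlet term is replaced by its linearisation at the limit, which lies below it
  and converges by Cauchy-Schwarz. The zero order term converges by dominated convergence, because
  all values lie in [0,1].\<close>

lemma J_lower_semicontinuous:
  assumes F: "\<And>n. F n \<in> K" and f: "f \<in> K" and lim: "(\<lambda>n. sqn M (\<lambda>x. F n x - f x)) \<longlonglongrightarrow> 0"
    and ae: "AE x in M. (\<lambda>n. F n x) \<longlonglongrightarrow> f x" and J: "(\<lambda>n. J lam (F n)) \<longlonglongrightarrow> I"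
  shows "J lam f \<le> I"
proof -
  note lf = K_l2[OF f] note lF = K_l2[OF F]
  let ?e = "\<lambda>n. \<integral>x. snd (f x) \<bullet> snd (F n x - f x) \<partial>M"
  have ld: "l2 M (\<lambda>x. F n x - f x)" for n by (intro l2_diff lf lF)
  have ie: "integrable M (\<lambda>x. snd (f x) \<bullet> snd (F n x - f x))" for n
    by (intro l2_inner_integrable l2_components lf ld)
  have e2: "(?e n)\<^sup>2 \<le> sqn M (\<lambda>x. snd (f x)) * sqn M (\<lambda>x. F n x - f x)" for n
  proof -
    have "(?e n)\<^sup>2 \<le> sqn M (\<lambda>x. snd (f x)) * sqn M (\<lambda>x. snd (F n x - f x))"
      by (intro l2_Cauchy_Schwarz l2_components lf ld)
    also have "\<dots> \<le> sqn M (\<lambda>x. snd (f x)) * sqn M (\<lambda>x. F n x - f x)"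
      by (intro mult_left_mono l2_components ld sqn_nonneg)
    finally show ?thesis .
  qed
  have "(\<lambda>n. sqn M (\<lambda>x. snd (f x)) * sqn M (\<lambda>x. F n x - f x)) \<longlonglongrightarrow> 0"
    using lim by (auto intro!: tendsto_eq_intros)
  then have "(\<lambda>n. (?e n)\<^sup>2) \<longlonglongrightarrow> 0"
    by (rule Lim_null_comparison[rotated]) (use e2 in auto)
  then have "(\<lambda>n. sqrt ((?e n)\<^sup>2)) \<longlonglongrightarrow> sqrt 0" by (rule tendsto_real_sqrt)
  then have e: "?e \<longlonglongrightarrow> 0" by (simp add: tendsto_rabs_zero_iff)
  have h: "(\<lambda>n. \<integral>x. hfun p r lam (fst (F n x)) \<partial>M) \<longlonglongrightarrow> (\<integral>x. hfun p r lam (fst (f x)) \<partial>M)"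
  proof (rule integral_dominated_convergence)
    show "(\<lambda>x. hfun p r lam (fst (f x))) \<in> borel_measurable M"
      using K_integrable_hfun[OF f] by auto
    show "(\<lambda>x. hfun p r lam (fst (F n x))) \<in> borel_measurable M" for n
      using K_integrable_hfun[OF F] by auto
    show "integrable M (\<lambda>x. \<bar>lam\<bar> + 1 + 1 / (1 - r))"
      using finite_measure.integrable_const[OF finite_M] by blast
    show "AE x in M. norm (hfun p r lam (fst (F n x))) \<le> \<bar>lam\<bar> + 1 + 1 / (1 - r)" for n
      using K_AE[OF F] by eventually_elim (use hfun_bound[OF p r] in auto)
    have "AE x in M. \<forall>n. 0 \<le> fst (F n x)"
      unfolding AE_all_countable using K_AE[OF F] by (auto elim: AE_mp)
    then show "AE x in M. (\<lambda>n. hfun p r lam (fst (F n x))) \<longlonglongrightarrow> hfun p r lam (fst (f x))"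
      using ae K_AE[OF f]
    proof eventually_elim
      case (elim x)
      show ?case
        by (rule continuous_on_tendsto_compose[OF continuous_on_hfun[OF p r] tendsto_fst[OF elim(2)]])
           (use elim in auto)
    qed
  qed
  have "(\<integral>x. (norm (snd (f x)))\<^sup>2 / 2 \<partial>M) + ?e n + (\<integral>x. hfun p r lam (fst (F n x)) \<partial>M) \<le> J lam (F n)" for n
  proof -
    have "(\<integral>x. (norm (snd (f x)))\<^sup>2 / 2 + snd (f x) \<bullet> snd (F n x - f x) + hfun p r lam (fst (F n x)) \<partial>M) \<le> J lam (F n)"
      unfolding J_def
    proof (rule integral_mono[OF _ integrable_density[OF F]])
      show "integrable M (\<lambda>x. (norm (snd (f x)))\<^sup>2 / 2 + snd (f x) \<bullet> snd (F n x - f x) + hfun p r lam (fst (F n x)))"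
        using integrable_snd[OF lf] ie K_integrable_hfun[OF F] by auto
      fix x
      have "0 \<le> (norm (snd (F n x) - snd (f x)))\<^sup>2" by simp
      then show "(norm (snd (f x)))\<^sup>2 / 2 + snd (f x) \<bullet> snd (F n x - f x) + hfun p r lam (fst (F n x)) \<le> density lam (F n x)"
        unfolding density_def power2_norm_eq_inner by (simp add: algebra_simps inner_commute)
    qed
    then show ?thesis
      using integrable_snd[OF lf] ie[of n] K_integrable_hfun[OF F, of lam n] by simp
  qed
  moreover have "(\<lambda>n. (\<integral>x. (norm (snd (f x)))\<^sup>2 / 2 \<partial>M) + ?e n + (\<integral>x. hfun p r lam (fst (F n x)) \<partial>M))
      \<longlonglongrightarrow> (\<integral>x. (norm (snd (f x)))\<^sup>2 / 2 \<partial>M) + 0 + (\<integral>x. hfun p r lam (fst (f x)) \<partial>M)"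
    by (intro tendsto_intros e h)
  ultimately have "(\<integral>x. (norm (snd (f x)))\<^sup>2 / 2 \<partial>M) + 0 + (\<integral>x. hfun p r lam (fst (f x)) \<partial>M) \<le> I"
    using J by (intro LIMSEQ_le) auto
  then show ?thesis
    unfolding J_def density_def using integrable_snd[OF lf] K_integrable_hfun[OF f] by simp
qed

lemma K_closed:
  assumes F: "\<And>n. F n \<in> K" and f: "l2 M f" and lim: "(\<lambda>n. sqn M (\<lambda>x. F n x - f x)) \<longlonglongrightarrow> 0"
    and ae: "AE x in M. (\<lambda>n. F n x) \<longlonglongrightarrow> f x"
  shows "f \<in> K"
proof (rule KI[OF V_closed[OF K_V[OF F] f lim]])
  have "AE x in M. \<forall>n. 0 \<le> fst (F n x) \<and> fst (F n x) \<le> 1"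
    unfolding AE_all_countable using K_AE[OF F] by auto
  then show "AE x in M. 0 \<le> fst (f x) \<and> fst (f x) \<le> 1" using ae
  proof eventually_elim
    case (elim x)
    have "(\<lambda>n. fst (F n x)) \<longlonglongrightarrow> fst (f x)" by (rule tendsto_fst[OF elim(2)])
    then show ?case using elim(1) by (auto intro: LIMSEQ_le_const LIMSEQ_le_const2)
  qed
qed

section \<open>Existence, quadratic growth and uniqueness of minimisers\<close>

definition minimiser :: "real \<Rightarrow> (real^'n \<Rightarrow> real \<times> (real^'n)) \<Rightarrow> bool" where
  "minimiser lam F \<longleftrightarrow> F \<in> K \<and> (\<forall>G\<in>K. J lam F \<le> J lam G)"

lemma minimiser_exists:
  assumes lam: "p \<le> lam"
  shows "\<exists>F. minimiser lam F"
proof -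
  define I where "I = Inf (J lam ` K)"
  have bdd: "bdd_below (J lam ` K)" using J_lower by (intro bdd_belowI2)
  have I: "I \<le> J lam G" if "G \<in> K" for G
    unfolding I_def using that bdd by (intro cInf_lower) auto
  have "\<exists>F. F \<in> K \<and> J lam F < I + inverse (real (Suc n))" for n
    using cInf_lessD[of "J lam ` K" "I + inverse (real (Suc n))"] zero_K
    unfolding I_def by (auto simp: image_iff)
  then obtain F where F: "\<And>n. F n \<in> K" "\<And>n. J lam (F n) < I + inverse (real (Suc n))"
    by metis
  \<comment> \<open>The midpoint still has energy at least \<open>I\<close>, so an eighth of the
    squared distance is at most the mean of the two excesses; hence the factor 4.\<close>
  have d: "sqn M (\<lambda>x. F i x - F j x) \<le> 4 * inverse (real (Suc i)) + 4 * inverse (real (Suc j))" for i j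
    using I[OF J_midpoint(1)[OF F(1)[of i] F(1)[of j] lam]] J_midpoint(2)[OF F(1)[of i] F(1)[of j] lam]
      F(2)[of i] F(2)[of j] by argo
  obtain f where f: "l2 M f" "(\<lambda>n. sqn M (\<lambda>x. F n x - f x)) \<longlonglongrightarrow> 0"
  proof (rule l2_complete[OF finite_M K_l2[OF F(1)]])
    fix e :: real assume "e > 0"
    then obtain N where N: "inverse (real (Suc N)) < e / 8"
      using reals_Archimedean[of "e / 8"] by auto
    show "\<exists>N. \<forall>i\<ge>N. \<forall>j\<ge>N. sqn M (\<lambda>x. F i x - F j x) < e"
    proof (intro exI allI impI)
      fix i j assume "N \<le> i" "N \<le> j"
      then have "inverse (real (Suc i)) \<le> inverse (real (Suc N))" "inverse (real (Suc j)) \<le> inverse (real (Suc N))"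
        by (auto intro!: le_imp_inverse_le)
      then show "sqn M (\<lambda>x. F i x - F j x) < e" using N d[of i j] by linarith
    qed
  qed blast
  obtain s where s: "strict_mono s" "AE x in M. (\<lambda>n. F (s n) x) \<longlonglongrightarrow> f x"
    using AE_subseq_of_sqn[of M F f, OF K_l2[OF F(1)] f] by blast
  have f': "(\<lambda>n. sqn M (\<lambda>x. F (s n) x - f x)) \<longlonglongrightarrow> 0"
    using LIMSEQ_subseq_LIMSEQ[OF f(2) s(1)] by (simp add: o_def)
  have "(\<lambda>n. J lam (F n)) \<longlonglongrightarrow> I"
  proof (rule tendsto_sandwich[OF _ _ tendsto_const])
    show "(\<lambda>n. I + inverse (real (Suc n))) \<longlonglongrightarrow> I" by (rule LIMSEQ_inverse_real_of_nat_add)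
  qed (use I F less_imp_le in \<open>blast intro: always_eventually\<close>)+
  then have J: "(\<lambda>n. J lam (F (s n))) \<longlonglongrightarrow> I"
    using LIMSEQ_subseq_LIMSEQ[OF _ s(1)] by (fastforce simp: o_def)
  have fK: "f \<in> K" by (rule K_closed[OF F(1) f(1) f' s(2)])
  have "J lam f \<le> I" by (rule J_lower_semicontinuous[OF F(1) fK f' s(2) J])
  then show ?thesis unfolding minimiser_def using I fK by (meson order_trans)
qed

text \<open>The midpoint of G and F is a competitor for F. This quantitative form of uniqueness is
  also what makes the mass depend on \<open>lam\<close> in a Lipschitz way.\<close>

lemma minimiser_growth:
  assumes lam: "p \<le> lam" and F: "minimiser lam F" and G: "G \<in> K"
  shows "sqn M (\<lambda>x. G x - F x) \<le> 4 * (J lam G - J lam F)"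
proof -
  have FK: "F \<in> K" using F by (simp add: minimiser_def)
  have "J lam F \<le> J lam (\<lambda>x. (1/2) *\<^sub>R G x + (1/2) *\<^sub>R F x)"
    using F J_midpoint(1)[OF G FK lam] by (simp add: minimiser_def)
  then show ?thesis using J_midpoint(2)[OF G FK lam] by argo
qed

lemma minimiser_eq_AE:
  assumes lam: "p \<le> lam" and F: "minimiser lam F" and G: "G \<in> K" and J: "J lam G \<le> J lam F"
  shows "AE x in M. G x = F x"
proof -
  have l: "l2 M (\<lambda>x. G x - F x)" using F G K_l2 by (auto simp: minimiser_def intro: l2_diff)
  have "sqn M (\<lambda>x. G x - F x) = 0"
    using minimiser_growth[OF lam F G] J sqn_nonneg[of M "\<lambda>x. G x - F x"] by argo
  then have "AE x in M. (norm (G x - F x))\<^sup>2 = 0"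
    unfolding sqn_def using l2_integrable[OF l] by (subst (asm) integral_nonneg_eq_0_iff_AE) auto
  then show ?thesis by eventually_elim simp
qed

end

section \<open>Pointwise bounds for minimisers\<close>

context singular_problem
begin

text \<open>Truncation at 1/2 removes gradient energy and moves values down along the interval where
  \<open>hfun\<close> is nondecreasing, so the energy does not grow; uniqueness then identifies the
  truncation with F.\<close>

lemma minimiser_upper_bound:
  assumes lam: "p \<le> lam" "6 \<le> lam" and F: "minimiser lam F"
  shows "AE x in M. fst (F x) \<le> 1 / 2"
proof -
  have FK: "F \<in> K" using F by (simp add: minimiser_def)
  let ?q = "\<lambda>_ :: real^'n. - (1 / 2) :: real"
  have g: "grad ?q x = 0" for x by (rule grad_eqI) simp
  \<comment> \<open>The constant -1/2 is never positive, so the empty set serves as the compact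
    set.\<close>
  have R: "(\<lambda>x. if 1 * fst (F x) + ?q x > 0 then (1 * fst (F x) + ?q x, 1 *\<^sub>R snd (F x) + grad ?q x) else 0) \<in> V"
    (is "?R \<in> V")
    by (rule V_positive_part[OF K_V[OF FK] smooth_on_const, of "{}"]) auto
  define H where "H = (\<lambda>x. 1 *\<^sub>R F x + (- 1) *\<^sub>R ?R x)"
  have H: "H x = (if fst (F x) > 1 / 2 then (1 / 2, 0) else F x)" for x
    by (simp add: H_def g prod_eq_iff)
  have HK: "H \<in> K"
  proof (rule KI)
    show "H \<in> V" unfolding H_def by (rule V_linear[OF K_V[OF FK] R])
    show "AE x in M. 0 \<le> fst (H x) \<and> fst (H x) \<le> 1"
      using K_AE[OF FK] by eventually_elim (simp add: H)
  qed
  have "J lam H \<le> J lam F" unfolding J_def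
  proof (rule integral_mono_AE[OF integrable_density[OF HK] integrable_density[OF FK]])
    show "AE x in M. density lam (H x) \<le> density lam (F x)"
      using K_AE[OF FK]
    proof eventually_elim
      case (elim x)
      then have "hfun p r lam (1 / 2) \<le> hfun p r lam (fst (F x))" if "fst (F x) > 1 / 2"
        using hfun_mono[OF p r lam(2), of "1 / 2" "fst (F x)"] that by simp
      then show ?case by (auto simp: H density_def intro: add_increasing)
    qed
  qed
  from minimiser_eq_AE[OF lam(1) F HK this] show ?thesis
    by eventually_elim (metis H fst_conv linorder_not_less order_refl)
qed

text \<open>The subsolution property at a point where the paraboloid has the value q, with
  \<open>N\<close> the dimension. As q is at most 1, the singular term contributes at least 1, and s
  is so small that 2 N s + lam q stays below that.\<close>

lemma hder_barrier_le:
  assumes "0 < q" "q \<le> s * R\<^sup>2" "s * R\<^sup>2 \<le> 1" "p \<le> lam"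
    and "s * (2 * N + lam * R\<^sup>2) \<le> 1"
  shows "hder p r lam q \<le> - (2 * N * s)"
proof -
  have "q powr 0 \<le> q powr (- r)" using assms r by (intro powr_mono') auto
  then have "1 \<le> q powr (- r)" using assms(1) by simp
  moreover have "lam * q \<le> lam * (s * R\<^sup>2)" using assms p by (intro mult_left_mono) auto
  moreover have "s * (2 * N + lam * R\<^sup>2) = 2 * N * s + lam * (s * R\<^sup>2)" by (simp add: algebra_simps)
  moreover have "0 \<le> q powr (p - 1)" by simp
  ultimately show ?thesis using assms(5) unfolding hder_def by linarith
qed

text \<open>The competitor is the maximum of u and the paraboloid q. Where u < q, both energy terms
  are linearised at q, since u might vanish there: h(q) is at most h(u) - 2 N s (q - u), and the
  gradient term changes by at most grad q . grad (q - u). Integrated, the two corrections cancel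
  exactly by integration by parts against the positive part of q - u.\<close>

lemma minimiser_barrier:
  assumes lam: "p \<le> lam" and F: "minimiser lam F" and R: "R > 0" "cball a R \<subseteq> \<Omega>"
  shows "\<exists>s>0. AE x in M. barrier s R a x \<le> fst (F x)"
proof -
  have FK: "F \<in> K" using F by (simp add: minimiser_def)
  let ?N = "real CARD('n)"
  \<comment> \<open>The reciprocal of a number that dominates both \<open>R\<^sup>2\<close> and
    \<open>2 * ?N + lam * R\<^sup>2\<close> satisfies the two smallness conditions on
    \<open>s\<close> at once.\<close>
  define D where "D = 2 * ?N + lam * R\<^sup>2 + R\<^sup>2"
  define s where "s = 1 / D"
  have lam0: "0 \<le> lam" using lam p by simp
  have D: "0 < D" unfolding D_def using R lam0 by (intro add_nonneg_pos) auto
  then have s: "0 < s" by (simp add: s_def)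
  have s1: "s * R\<^sup>2 \<le> 1" using D lam0 by (simp add: s_def divide_simps) (simp add: D_def)
  have s2: "s * (2 * ?N + lam * R\<^sup>2) \<le> 1" using D by (simp add: s_def divide_simps) (simp add: D_def)
  let ?q = "barrier s R a"
  have qpos: "x \<in> cball a R" if "?q x > 0" for x
  proof -
    have "(norm (x - a))\<^sup>2 < R\<^sup>2" using that s by (simp add: barrier_def zero_less_mult_iff)
    then have "norm (x - a) < R" using R by (simp add: power_less_imp_less_base)
    then show ?thesis by (simp add: dist_norm norm_minus_commute)
  qed
  have qle: "?q x \<le> s * R\<^sup>2" for x using s by (simp add: barrier_def)
  have RV: "(\<lambda>x. if (- 1) * fst (F x) + ?q x > 0
      then ((- 1) * fst (F x) + ?q x, (- 1) *\<^sub>R snd (F x) + grad ?q x) else 0) \<in> V" (is "?R \<in> V")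
    by (rule V_positive_part[OF K_V[OF FK] smooth_on_barrier compact_cball R(2) qpos])
  define H where "H = (\<lambda>x. 1 *\<^sub>R F x + 1 *\<^sub>R ?R x)"
  have H: "H x = (if fst (F x) < ?q x then jet ?q x else F x)" for x
    by (simp add: H_def jet_def prod_eq_iff)
  have HK: "H \<in> K"
  proof (rule KI)
    show "H \<in> V" unfolding H_def by (rule V_linear[OF K_V[OF FK] RV])
    show "AE x in M. 0 \<le> fst (H x) \<and> fst (H x) \<le> 1"
      using K_AE[OF FK]
    proof eventually_elim
      case (elim x)
      then show ?case using qle[of x] s1 by (auto simp: H jet_def)
    qed
  qed
  have i1: "integrable M (\<lambda>x. grad ?q x \<bullet> snd (?R x))"
    by (intro l2_inner_integrable l2_continuous continuous_on_grad smooth_on_barrier l2_components V_l2 RV)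
  have i2: "integrable M (\<lambda>x. fst (?R x))"
    by (intro l2_integrable_self l2_components V_l2 RV)
  have split: "(\<integral>x. f x + (g x - c * h x) \<partial>M) = integral\<^sup>L M f + (integral\<^sup>L M g - c * integral\<^sup>L M h)"
    if "integrable M f" "integrable M g" "integrable M h" for f g h :: "real^'n \<Rightarrow> real" and c
    using that by simp
  have "J lam H \<le> (\<integral>x. density lam (F x) + (grad ?q x \<bullet> snd (?R x) - 2 * ?N * s * fst (?R x)) \<partial>M)"
    unfolding J_def
  proof (rule integral_mono_AE[OF integrable_density[OF HK]])
    show "integrable M (\<lambda>x. density lam (F x) + (grad ?q x \<bullet> snd (?R x) - 2 * ?N * s * fst (?R x)))"
      using integrable_density[OF FK] i1 i2
      by (intro Bochner_Integration.integrable_add Bochner_Integration.integrable_diff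
          integrable_mult_right) auto
    show "AE x in M. density lam (H x) \<le> density lam (F x) + (grad ?q x \<bullet> snd (?R x) - 2 * ?N * s * fst (?R x))"
      using K_AE[OF FK]
    proof eventually_elim
      case (elim x)
      show ?case
      proof (cases "fst (F x) < ?q x")
        case False
        then show ?thesis by (simp add: H)
      next
        case True
        let ?u = "fst (F x)" and ?G = "snd (F x)" and ?g = "grad ?q x"
        have q01: "0 < ?q x" "?q x \<le> 1" using elim True qle[of x] s1 by auto
        have "hfun p r lam (?q x) + hder p r lam (?q x) * (?u - ?q x) + (?u - ?q x)\<^sup>2 / 2 \<le> hfun p r lam ?u"
          by (rule hfun_tangent[OF p r lam q01]) (use elim in auto)
        moreover have "0 \<le> (?u - ?q x)\<^sup>2" by simp
        moreover have "hder p r lam (?q x) * (?q x - ?u) \<le> - (2 * ?N * s) * (?q x - ?u)"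
          by (rule mult_right_mono[OF hder_barrier_le[OF q01(1) qle s1 lam s2]]) (use True in simp)
        moreover have "hder p r lam (?q x) * (?u - ?q x) = - (hder p r lam (?q x) * (?q x - ?u))"
          by (simp add: algebra_simps)
        ultimately have 1: "hfun p r lam (?q x) \<le> hfun p r lam ?u - 2 * ?N * s * (?q x - ?u)"
          by argo
        have "0 \<le> (norm (?g - ?G))\<^sup>2" by simp
        then have 2: "(norm ?g)\<^sup>2 / 2 \<le> (norm ?G)\<^sup>2 / 2 + ?g \<bullet> (?g - ?G)"
          unfolding power2_norm_eq_inner by (simp add: algebra_simps inner_commute)
        have "?R x = (?q x - ?u, ?g - ?G)" using True by simp
        moreover have "H x = (?q x, ?g)" using True by (simp add: H jet_def)
        ultimately show ?thesis using 1 2 by (simp add: density_def)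
      qed
    qed
  qed
  also have "\<dots> = J lam F + ((\<integral>x. grad ?q x \<bullet> snd (?R x) \<partial>M) - 2 * ?N * s * (\<integral>x. fst (?R x) \<partial>M))"
    unfolding J_def by (rule split[OF integrable_density[OF FK] i1 i2])
  also have "\<dots> = J lam F" using barrier_integration_by_parts[OF RV, of s R a] by simp
  finally have "AE x in M. H x = F x" by (rule minimiser_eq_AE[OF lam F HK])
  then have "AE x in M. ?q x \<le> fst (F x)"
    by eventually_elim (metis H jet_def fst_conv linorder_not_less order_refl)
  then show ?thesis using s by blast
qed

text \<open>On the concentric ball of half the radius the paraboloid is at least 3/4 of its height s
  R^2; finitely many such balls cover \<open>C\<close>.\<close>

lemma minimiser_lower_bound:
  assumes lam: "p \<le> lam" and F: "minimiser lam F" and C: "compact C" "C \<subseteq> \<Omega>"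
  shows "\<exists>d>0. AE x in M. x \<in> C \<longrightarrow> d \<le> fst (F x)"
proof -
  have ex: "\<exists>R d. 0 < R \<and> 0 < d \<and> (AE x in M. x \<in> ball a R \<longrightarrow> d \<le> fst (F x))" if aC: "a \<in> C" for a
  proof -
    obtain R where R: "R > 0" "cball a R \<subseteq> \<Omega>"
      using open_\<Omega>[unfolded open_contains_cball] aC C(2) by blast
    obtain s where s: "s > 0" "AE x in M. barrier s R a x \<le> fst (F x)"
      using minimiser_barrier[OF lam F R] by blast
    have "AE x in M. x \<in> ball a (R / 2) \<longrightarrow> s * (3 / 4 * R\<^sup>2) \<le> fst (F x)"
      using s(2)
    proof eventually_elim
      case (elim x)
      show ?case
      proof
        assume x: "x \<in> ball a (R / 2)"
        then have "norm (x - a) \<le> R / 2" by (simp add: dist_norm norm_minus_commute)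
        then have "(norm (x - a))\<^sup>2 \<le> (R / 2)\<^sup>2" by (intro power_mono) auto
        then have "3 / 4 * R\<^sup>2 \<le> R\<^sup>2 - (norm (x - a))\<^sup>2" by (simp add: power_divide)
        then have "s * (3 / 4 * R\<^sup>2) \<le> barrier s R a x"
          unfolding barrier_def using s(1) by (intro mult_left_mono) auto
        then show "s * (3 / 4 * R\<^sup>2) \<le> fst (F x)" using elim by simp
      qed
    qed
    moreover have "0 < s * (3 / 4 * R\<^sup>2)" "0 < R / 2" using s R by auto
    ultimately show ?thesis by blast
  qed
  have "\<exists>z. 0 < fst z \<and> 0 < snd z \<and> (AE x in M. x \<in> ball a (fst z) \<longrightarrow> snd z \<le> fst (F x))"
    if "a \<in> C" for a using ex[OF that] by (simp add: split_paired_Ex)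
  then obtain Z where Z: "\<forall>a\<in>C. 0 < fst (Z a) \<and> 0 < snd (Z a)
      \<and> (AE x in M. x \<in> ball a (fst (Z a)) \<longrightarrow> snd (Z a) \<le> fst (F x))"
    using bchoice[of C "\<lambda>a z. 0 < fst z \<and> 0 < snd z
      \<and> (AE x in M. x \<in> ball a (fst z) \<longrightarrow> snd z \<le> fst (F x))"] by blast
  define R d where "R a = fst (Z a)" and "d a = snd (Z a)" for a
  have Rd: "0 < R a" "0 < d a" "AE x in M. x \<in> ball a (R a) \<longrightarrow> d a \<le> fst (F x)" if "a \<in> C" for a
    using bspec[OF Z that] by (simp_all add: R_def d_def)
  obtain T where T: "T \<subseteq> C" "finite T" "C \<subseteq> (\<Union>a\<in>T. ball a (R a))"
    using compactE_image[OF C(1), of C "\<lambda>a. ball a (R a)"] Rd(1) by force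
  \<comment> \<open>The inserted 1 keeps the minimum meaningful when \<open>T\<close> is
    empty.\<close>
  let ?d = "Min (insert 1 (d ` T))"
  have "AE x in M. \<forall>a\<in>T. x \<in> ball a (R a) \<longrightarrow> d a \<le> fst (F x)"
    using Rd(3) T by (intro AE_finite_allI) auto
  then have "AE x in M. x \<in> C \<longrightarrow> ?d \<le> fst (F x)"
  proof eventually_elim
    case (elim x)
    show ?case
    proof
      assume "x \<in> C"
      then obtain a where a: "a \<in> T" "x \<in> ball a (R a)" using T(3) by blast
      have "?d \<le> d a" using a(1) T(2) by (intro Min_le) auto
      moreover have "d a \<le> fst (F x)" using elim a by blast
      ultimately show "?d \<le> fst (F x)" by (rule order_trans)
    qed
  qed
  moreover have "0 < ?d" using T Rd(2) by (subst Min_gr_iff) auto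
  ultimately show ?thesis by blast
qed

end

section \<open>The Euler--Lagrange equation\<close>

context singular_problem
begin

lemma minimiser_on_support:
  assumes lam: "p \<le> lam" "6 \<le> lam" and F: "minimiser lam F" and \<phi>: "test_fun \<Omega> \<phi>"
  obtains d where "d > 0" "AE x in M. 0 \<le> fst (F x) \<and> fst (F x) \<le> 1 / 2 \<and> (\<phi> x \<noteq> 0 \<longrightarrow> d \<le> fst (F x))"
proof -
  obtain C where C: "compact C" "C \<subseteq> \<Omega>" "\<And>x. x \<notin> C \<Longrightarrow> \<phi> x = 0"
    by (rule test_fun_support[OF \<phi>]) blast
  obtain d where d: "d > 0" "AE x in M. x \<in> C \<longrightarrow> d \<le> fst (F x)"
    using minimiser_lower_bound[OF lam(1) F C(1,2)] by blast
  have FK: "F \<in> K" using F by (simp add: minimiser_def)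
  have "AE x in M. 0 \<le> fst (F x) \<and> fst (F x) \<le> 1 / 2 \<and> (\<phi> x \<noteq> 0 \<longrightarrow> d \<le> fst (F x))"
    using d(2) K_AE[OF FK] minimiser_upper_bound[OF lam F]
    by eventually_elim (use C(3) in auto)
  with d(1) show ?thesis by (rule that)
qed

text \<open>A one-sided inequality obtained without differentiating the energy: the tangent
  inequality based at the varied function, not at F, bounds the energy increase by t times an
  explicit integral. Minimality makes that integral nonnegative, and dominated convergence lets t
  tend to 0, since on the set where \<phi> is nonzero all arguments of \<open>hder\<close> stay
  above d/2.\<close>

lemma minimiser_variation_ge_0:
  assumes lam: "p \<le> lam" "6 \<le> lam" and F: "minimiser lam F" and \<phi>: "test_fun \<Omega> \<phi>"
  shows "0 \<le> (\<integral>x. snd (F x) \<bullet> grad \<phi> x \<partial>M) + (\<integral>x. hder p r lam (fst (F x)) * \<phi> x \<partial>M)"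
proof -
  have FK: "F \<in> K" using F by (simp add: minimiser_def)
  obtain d where d: "d > 0"
    and ae: "AE x in M. 0 \<le> fst (F x) \<and> fst (F x) \<le> 1 / 2 \<and> (\<phi> x \<noteq> 0 \<longrightarrow> d \<le> fst (F x))"
    by (rule minimiser_on_support[OF lam F \<phi>])
  obtain B where B: "B > 0" "\<And>x. \<bar>\<phi> x\<bar> \<le> B" by (rule test_fun_bounded[OF \<phi>]) blast
  note sm = test_fun_smooth[OF \<phi>]
  note [measurable] = borel_measurable_components[OF l2_measurable[OF K_l2[OF FK]]]
  have [measurable]: "\<phi> \<in> borel_measurable M"
    by (intro l2_measurable l2_continuous smooth_on_continuous sm)
  \<comment> \<open>Dividing by \<open>B\<close> makes the perturbation at most d/2, so the values
    stay above d/2 where \<phi> is nonzero, and at most 1/2, so they stay below 1.\<close>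
  define t where "t n = min (d / 2) (1 / 2) / B * inverse (real (Suc n))" for n
  have t0: "0 < t n" for n unfolding t_def using d B by simp
  have tlim: "t \<longlonglongrightarrow> 0"
    unfolding t_def[abs_def] by (rule tendsto_mult_right_zero[OF LIMSEQ_inverse_real_of_nat])
  have t\<phi>: "\<bar>t n * \<phi> x\<bar> \<le> min (d / 2) (1 / 2)" for n x
  proof -
    have "\<bar>t n * \<phi> x\<bar> \<le> t n * B" unfolding abs_mult using t0[of n] B(2)[of x] by (intro mult_mono) auto
    also have "\<dots> = min (d / 2) (1 / 2) * inverse (real (Suc n))" using B(1) by (simp add: t_def)
    also have "\<dots> \<le> min (d / 2) (1 / 2) * 1" using d by (intro mult_left_mono) (auto simp: inverse_le_1_iff)
    finally show ?thesis by simp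
  qed
  define w where "w n x = fst (F x) + t n * \<phi> x" for n x
  have [measurable]: "w n \<in> borel_measurable M" for n unfolding w_def[abs_def] by measurable
  have wae: "AE x in M. 0 \<le> w n x \<and> w n x \<le> 1 \<and> (\<phi> x \<noteq> 0 \<longrightarrow> d / 2 \<le> w n x)" for n
    using ae
  proof eventually_elim
    case (elim x)
    show ?case using elim t\<phi>[of n x] by (cases "\<phi> x = 0") (auto simp: w_def abs_le_iff)
  qed
  define H where "H n = (\<lambda>x. 1 *\<^sub>R F x + t n *\<^sub>R jet \<phi> x)" for n
  have fstH: "fst (H n x) = w n x" and sndH: "snd (H n x) = snd (F x) + t n *\<^sub>R grad \<phi> x" for n x
    by (simp_all add: H_def w_def jet_def)
  have HK: "H n \<in> K" for n
  proof (rule KI)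
    show "H n \<in> V" unfolding H_def by (rule V_linear[OF K_V[OF FK] V_jet[OF \<phi>]])
    show "AE x in M. 0 \<le> fst (H n x) \<and> fst (H n x) \<le> 1"
      using wae[of n] by eventually_elim (simp add: fstH)
  qed
  let ?C = "(\<bar>lam\<bar> + 1 + (d / 2) powr (- r)) * B"
  have hb: "AE x in M. norm (hder p r lam (w n x) * \<phi> x) \<le> ?C" for n
    using wae[of n]
  proof eventually_elim
    case (elim x)
    show ?case
    proof (cases "\<phi> x = 0")
      case True
      then show ?thesis using B(1) by simp
    next
      case False
      then show ?thesis unfolding real_norm_def abs_mult
        by (intro mult_mono B(2) hder_bound[OF p r(1)]) (use elim d in auto)
    qed
  qed
  have ih: "integrable M (\<lambda>x. hder p r lam (w n x) * \<phi> x)" for n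
    by (rule finite_measure.integrable_const_bound[OF finite_M hb]) measurable
  have i1: "integrable M (\<lambda>x. snd (F x) \<bullet> grad \<phi> x)"
    by (intro l2_inner_integrable l2_components K_l2[OF FK] l2_continuous continuous_on_grad sm)
  have i2: "integrable M (\<lambda>x. (norm (grad \<phi> x))\<^sup>2)"
    by (intro l2_integrable l2_continuous continuous_on_grad sm)
  let ?I1 = "\<integral>x. snd (F x) \<bullet> grad \<phi> x \<partial>M" and ?I2 = "\<integral>x. (norm (grad \<phi> x))\<^sup>2 \<partial>M"
  let ?I3 = "\<lambda>n. \<integral>x. hder p r lam (w n x) * \<phi> x \<partial>M"
  have ge: "0 \<le> ?I1 + t n / 2 * ?I2 + ?I3 n" for n
  proof -
    let ?g = "\<lambda>x. snd (F x) \<bullet> grad \<phi> x + t n / 2 * (norm (grad \<phi> x))\<^sup>2 + hder p r lam (w n x) * \<phi> x"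
    have ig: "integrable M ?g" using i1 i2 ih[of n] by auto
    have "J lam (H n) \<le> (\<integral>x. density lam (F x) + t n * ?g x \<partial>M)"
      unfolding J_def
    proof (rule integral_mono_AE[OF integrable_density[OF HK]])
      show "integrable M (\<lambda>x. density lam (F x) + t n * ?g x)"
        using integrable_density[OF FK] ig by auto
      show "AE x in M. density lam (H n x) \<le> density lam (F x) + t n * ?g x"
        using wae[of n] ae
      proof eventually_elim
        case (elim x)
        have 1: "(norm (snd (H n x)))\<^sup>2 / 2 = (norm (snd (F x)))\<^sup>2 / 2 + t n * (snd (F x) \<bullet> grad \<phi> x)
            + t n * (t n / 2 * (norm (grad \<phi> x))\<^sup>2)"
          unfolding sndH power2_norm_eq_inner
          by (simp add: algebra_simps inner_commute add_divide_distrib)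
        have 2: "hfun p r lam (w n x) \<le> hfun p r lam (fst (F x)) + t n * (hder p r lam (w n x) * \<phi> x)"
        proof (cases "\<phi> x = 0")
          case True
          then show ?thesis by (simp add: w_def)
        next
          case False
          have "hfun p r lam (w n x) + hder p r lam (w n x) * (fst (F x) - w n x) + (fst (F x) - w n x)\<^sup>2 / 2
              \<le> hfun p r lam (fst (F x))"
            by (rule hfun_tangent[OF p r lam(1)]) (use elim False d in auto)
          moreover have "0 \<le> (fst (F x) - w n x)\<^sup>2" by simp
          moreover have "hder p r lam (w n x) * (fst (F x) - w n x) = - (t n * (hder p r lam (w n x) * \<phi> x))"
            by (simp add: w_def)
          ultimately show ?thesis by argo
        qed
        show ?case using 2 unfolding density_def fstH 1 distrib_left by simp
      qed
    qed
    also have "\<dots> = J lam F + t n * integral\<^sup>L M ?g"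
      unfolding J_def using integrable_density[OF FK] ig
      by (subst Bochner_Integration.integral_add) auto
    finally have "0 \<le> t n * integral\<^sup>L M ?g"
      using F HK[of n] unfolding minimiser_def by force
    then have "0 \<le> integral\<^sup>L M ?g" using t0[of n] by (simp add: zero_le_mult_iff)
    also have "integral\<^sup>L M ?g = ?I1 + t n / 2 * ?I2 + ?I3 n"
      using i1 i2 ih[of n] by simp
    finally show ?thesis .
  qed
  have l3: "?I3 \<longlonglongrightarrow> (\<integral>x. hder p r lam (fst (F x)) * \<phi> x \<partial>M)"
  proof (rule integral_dominated_convergence[where w = "\<lambda>_. ?C"])
    show "integrable M (\<lambda>_. ?C)" using finite_measure.integrable_const[OF finite_M] by blast
    show "AE x in M. norm (hder p r lam (w n x) * \<phi> x) \<le> ?C" for n by (rule hb)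
    show "AE x in M. (\<lambda>n. hder p r lam (w n x) * \<phi> x) \<longlonglongrightarrow> hder p r lam (fst (F x)) * \<phi> x"
      using ae
    proof eventually_elim
      case (elim x)
      show ?case
      proof (cases "\<phi> x = 0")
        case False
        have "(\<lambda>n. w n x) \<longlonglongrightarrow> fst (F x) + 0 * \<phi> x"
          unfolding w_def by (intro tendsto_intros tlim)
        then have "(\<lambda>n. hder p r lam (w n x)) \<longlonglongrightarrow> hder p r lam (fst (F x))"
          using elim False d by (intro isCont_tendsto_compose[OF isCont_hder]) auto
        then show ?thesis by (intro tendsto_intros)
      qed simp
    qed
  qed measurable
  have l2: "(\<lambda>n. t n / 2 * ?I2) \<longlonglongrightarrow> 0"
    using tlim by (auto intro!: tendsto_eq_intros)
  have "(\<lambda>n. ?I1 + t n / 2 * ?I2 + ?I3 n) \<longlonglongrightarrow> ?I1 + 0 + (\<integral>x. hder p r lam (fst (F x)) * \<phi> x \<partial>M)"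
    by (rule tendsto_add[OF tendsto_add[OF tendsto_const l2] l3])
  then have "0 \<le> ?I1 + 0 + (\<integral>x. hder p r lam (fst (F x)) * \<phi> x \<partial>M)"
    by (rule LIMSEQ_le_const) (use ge in auto)
  then show ?thesis by simp
qed

lemma minimiser_Euler_Lagrange:
  assumes lam: "p \<le> lam" "6 \<le> lam" and F: "minimiser lam F" and \<phi>: "test_fun \<Omega> \<phi>"
  shows "integrable M (\<lambda>x. fst (F x) powr (- r) * \<phi> x)"
    and "integrable M (\<lambda>x. fst (F x) powr (p - 1) * \<phi> x)"
    and "(\<integral>x. snd (F x) \<bullet> grad \<phi> x \<partial>M) + lam * (\<integral>x. fst (F x) * \<phi> x \<partial>M) =
      (\<integral>x. fst (F x) powr (- r) * \<phi> x \<partial>M) + (\<integral>x. fst (F x) powr (p - 1) * \<phi> x \<partial>M)"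
proof -
  have FK: "F \<in> K" using F by (simp add: minimiser_def)
  obtain d where d: "d > 0"
    and ae: "AE x in M. 0 \<le> fst (F x) \<and> fst (F x) \<le> 1 / 2 \<and> (\<phi> x \<noteq> 0 \<longrightarrow> d \<le> fst (F x))"
    by (rule minimiser_on_support[OF lam F \<phi>])
  obtain B where B: "B > 0" "\<And>x. \<bar>\<phi> x\<bar> \<le> B" by (rule test_fun_bounded[OF \<phi>]) blast
  note sm = test_fun_smooth[OF \<phi>]
  note [measurable] = borel_measurable_components[OF l2_measurable[OF K_l2[OF FK]]]
  have l\<phi>: "l2 M \<phi>" by (intro l2_continuous smooth_on_continuous sm)
  note [measurable] = l2_measurable[OF l\<phi>]
  show i1: "integrable M (\<lambda>x. fst (F x) powr (- r) * \<phi> x)"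
  proof (rule finite_measure.integrable_const_bound[OF finite_M])
    show "AE x in M. norm (fst (F x) powr (- r) * \<phi> x) \<le> d powr (- r) * B"
      using ae
    proof eventually_elim
      case (elim x)
      show ?case
      proof (cases "\<phi> x = 0")
        case True
        then show ?thesis using B(1) by simp
      next
        case False
        then have "fst (F x) powr (- r) \<le> d powr (- r)" using elim d r by (intro powr_mono2') auto
        then show ?thesis using B(2)[of x] by (simp add: abs_mult mult_mono)
      qed
    qed
  qed measurable
  show i2: "integrable M (\<lambda>x. fst (F x) powr (p - 1) * \<phi> x)"
  proof (rule finite_measure.integrable_const_bound[OF finite_M])
    show "AE x in M. norm (fst (F x) powr (p - 1) * \<phi> x) \<le> 1 * B"
      using ae
    proof eventually_elim
      case (elim x)
      then have "fst (F x) powr (p - 1) \<le> 1" using p by (intro powr_le1) auto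
      then show ?case unfolding real_norm_def abs_mult using B(2)[of x] by (intro mult_mono) auto
    qed
  qed measurable
  have i3: "integrable M (\<lambda>x. fst (F x) * \<phi> x)"
    using l2_inner_integrable[OF l2_components(1)[OF K_l2[OF FK]] l\<phi>] by simp
  have h: "(\<integral>x. hder p r lam (fst (F x)) * \<phi> x \<partial>M) = lam * (\<integral>x. fst (F x) * \<phi> x \<partial>M)
      - (\<integral>x. fst (F x) powr (p - 1) * \<phi> x \<partial>M) - (\<integral>x. fst (F x) powr (- r) * \<phi> x \<partial>M)"
  proof -
    have "(\<integral>x. hder p r lam (fst (F x)) * \<phi> x \<partial>M) = (\<integral>x. lam * (fst (F x) * \<phi> x)
        - fst (F x) powr (p - 1) * \<phi> x - fst (F x) powr (- r) * \<phi> x \<partial>M)"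
      by (simp add: hder_def algebra_simps)
    then show ?thesis using i1 i2 i3 by simp
  qed
  \<comment> \<open>The negative of \<phi> is written as a linear combination so that the closure of
    test functions and the linearity of jets apply; both signs together give equality.\<close>
  have "test_fun \<Omega> (\<lambda>x. (- 1) * \<phi> x + 0 * \<phi> x)" by (intro test_fun_linear \<phi>)
  then have neg: "test_fun \<Omega> (\<lambda>x. - \<phi> x)" by simp
  have "jet (\<lambda>x. (- 1) * \<phi> x + 0 * \<phi> x) x = (- 1) *\<^sub>R jet \<phi> x + 0 *\<^sub>R jet \<phi> x" for x
    by (rule jet_linear[OF sm sm])
  then have "grad (\<lambda>x. - \<phi> x) x = - grad \<phi> x" for x by (simp add: jet_def)
  then have "0 \<le> - (\<integral>x. snd (F x) \<bullet> grad \<phi> x \<partial>M) - (\<integral>x. hder p r lam (fst (F x)) * \<phi> x \<partial>M)"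
    using minimiser_variation_ge_0[OF lam F neg] by simp
  then show "(\<integral>x. snd (F x) \<bullet> grad \<phi> x \<partial>M) + lam * (\<integral>x. fst (F x) * \<phi> x \<partial>M) =
      (\<integral>x. fst (F x) powr (- r) * \<phi> x \<partial>M) + (\<integral>x. fst (F x) powr (p - 1) * \<phi> x \<partial>M)"
    using minimiser_variation_ge_0[OF lam F \<phi>] h by simp
qed

end

section \<open>The mass of the minimisers\<close>

context singular_problem
begin

definition mass :: "(real^'n \<Rightarrow> real \<times> (real^'n)) \<Rightarrow> real" where
  "mass F = (\<integral>x. (fst (F x))\<^sup>2 \<partial>M)"

text \<open>The difference of squares factors as (a + b)(a - b) with a + b at most 2 on
  \<open>K\<close>; Cauchy-Schwarz against the constant 1 brings in the measure.\<close>

lemma mass_diff_le: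
  assumes F: "F \<in> K" and G: "G \<in> K"
  shows "(mass F - mass G)\<^sup>2 \<le> 4 * measure M (space M) * sqn M (\<lambda>x. F x - G x)"
proof -
  have i: "integrable M (\<lambda>x. (fst (P x))\<^sup>2)" if "P \<in> K" for P
    using l2_integrable[OF l2_components(1)[OF K_l2[OF that]]] by simp
  have l: "l2 M (\<lambda>x. F x - G x)" by (intro l2_diff K_l2 F G)
  have "\<bar>mass F - mass G\<bar> = \<bar>\<integral>x. (fst (F x))\<^sup>2 - (fst (G x))\<^sup>2 \<partial>M\<bar>"
    unfolding mass_def using i[OF F] i[OF G] by simp
  also have "\<dots> \<le> (\<integral>x. \<bar>(fst (F x))\<^sup>2 - (fst (G x))\<^sup>2\<bar> \<partial>M)"
    using integral_norm_bound[of M "\<lambda>x. (fst (F x))\<^sup>2 - (fst (G x))\<^sup>2"] by simp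
  also have "\<dots> \<le> (\<integral>x. 2 * norm (F x - G x) \<partial>M)"
  proof (rule integral_mono_AE)
    show "integrable M (\<lambda>x. \<bar>(fst (F x))\<^sup>2 - (fst (G x))\<^sup>2\<bar>)" using i[OF F] i[OF G] by auto
    show "integrable M (\<lambda>x. 2 * norm (F x - G x))" using l2_norm_integral(1)[OF finite_M l] by simp
    show "AE x in M. \<bar>(fst (F x))\<^sup>2 - (fst (G x))\<^sup>2\<bar> \<le> 2 * norm (F x - G x)"
      using K_AE[OF F] K_AE[OF G]
    proof eventually_elim
      case (elim x)
      have "\<bar>(fst (F x))\<^sup>2 - (fst (G x))\<^sup>2\<bar> = \<bar>fst (F x) + fst (G x)\<bar> * \<bar>fst (F x - G x)\<bar>"
        by (simp add: power2_eq_square algebra_simps flip: abs_mult)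
      also have "\<dots> \<le> 2 * norm (F x - G x)"
      proof (rule mult_mono)
        show "\<bar>fst (F x - G x)\<bar> \<le> norm (F x - G x)"
          by (simp add: norm_prod_def real_le_rsqrt)
      qed (use elim in auto)
      finally show ?case .
    qed
  qed
  finally have "\<bar>mass F - mass G\<bar> \<le> 2 * (\<integral>x. norm (F x - G x) \<partial>M)" by simp
  then have "(mass F - mass G)\<^sup>2 \<le> (2 * (\<integral>x. norm (F x - G x) \<partial>M))\<^sup>2"
    using power_mono[OF _ abs_ge_zero, of _ _ 2] by (simp only: power2_abs[of "mass F - mass G", symmetric])
  also have "\<dots> \<le> 4 * (sqn M (\<lambda>x. F x - G x) * measure M (space M))"
    using l2_norm_integral(2)[OF finite_M l] by (simp add: power_mult_distrib)
  finally show ?thesis by (simp add: mult_ac)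
qed

text \<open>Each minimiser is a competitor for the other. In the sum of the two growth inequalities
  only the difference of multipliers times the difference of masses survives;
  \<open>mass_diff_le\<close> makes this quadratic in the difference of masses, and one factor
  cancels.\<close>

lemma mass_lipschitz:
  assumes "p \<le> lam" "p \<le> lam'" and F: "minimiser lam F" and G: "minimiser lam' G"
  shows "\<bar>mass F - mass G\<bar> \<le> 4 * measure M (space M) * \<bar>lam - lam'\<bar>"
proof -
  have FK: "F \<in> K" and GK: "G \<in> K" using F G by (auto simp: minimiser_def)
  let ?S = "sqn M (\<lambda>x. F x - G x)" and ?D = "mass F - mass G"
  have a: "?S \<le> 4 * (J lam G - J lam F)"
    using minimiser_growth[OF assms(1) F GK] unfolding sqn_commute[of M G F] .
  have b: "?S \<le> 4 * (J lam' F - J lam' G)"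
    by (rule minimiser_growth[OF assms(2) G FK])
  have c: "J lam F = J lam' F + (lam - lam') / 2 * mass F" "J lam G = J lam' G + (lam - lam') / 2 * mass G"
    using J_lam FK GK by (auto simp: mass_def)
  have "2 * ?S \<le> 4 * ((lam - lam') / 2 * mass G - (lam - lam') / 2 * mass F)"
    using a b unfolding c by argo
  also have "\<dots> = 2 * ((lam' - lam) * ?D)" by (simp add: field_simps)
  also have "(lam' - lam) * ?D \<le> \<bar>lam - lam'\<bar> * \<bar>?D\<bar>"
    by (metis abs_ge_self abs_minus_commute abs_mult)
  finally have S: "?S \<le> \<bar>lam - lam'\<bar> * \<bar>?D\<bar>" by simp
  have "?D\<^sup>2 \<le> 4 * measure M (space M) * ?S" by (rule mass_diff_le[OF FK GK])
  also have "\<dots> \<le> 4 * measure M (space M) * (\<bar>lam - lam'\<bar> * \<bar>?D\<bar>)"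
    by (intro mult_left_mono S) simp
  finally have "\<bar>?D\<bar> * \<bar>?D\<bar> \<le> (4 * measure M (space M) * \<bar>lam - lam'\<bar>) * \<bar>?D\<bar>"
    by (simp add: power2_eq_square mult_ac)
  then show ?thesis
    by (cases "?D = 0") (simp_all only: mult_le_cancel_right abs_zero, auto)
qed

text \<open>The zero function has energy 0, so the energy of F is at most 0, while the part without
  \<open>lam\<close> is bounded below independently of \<open>lam\<close>. Thus the mass is
  O(1/lam).\<close>

lemma mass_upper:
  assumes "p \<le> lam" and F: "minimiser lam F"
  shows "lam / 2 * mass F \<le> (1 + 1 / (1 - r)) * measure M (space M)"
proof -
  have FK: "F \<in> K" using F by (simp add: minimiser_def)
  have "J 0 F + lam / 2 * mass F \<le> 0"
    using F zero_K J_zero[of lam] J_lam[OF FK, of lam 0] unfolding minimiser_def mass_def by force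
  moreover have "- ((1 + 1 / (1 - r)) * measure M (space M)) \<le> J 0 F"
    using J_lower[OF FK, of 0] by (simp only: abs_zero add_0 mult_minus_left)
  ultimately show ?thesis by linarith
qed

text \<open>An open set is a countable union of compact subsets, on each of which the local lower
  bound applies outside a null set.\<close>

lemma minimiser_positive:
  assumes lam: "p \<le> lam" and F: "minimiser lam F"
  shows "AE x in M. 0 < fst (F x)"
proof -
  obtain C :: "nat \<Rightarrow> (real^'n) set" where C: "\<And>n. compact (C n)" "\<And>n. C n \<subseteq> \<Omega>" "\<Union>(range C) = \<Omega>"
    using open_Union_compact_subsets[OF open_\<Omega>] by metis
  have "AE x in M. x \<in> C n \<longrightarrow> 0 < fst (F x)" for n
  proof -
    obtain d where "d > 0" "AE x in M. x \<in> C n \<longrightarrow> d \<le> fst (F x)"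
      using minimiser_lower_bound[OF lam F C(1,2)] by blast
    then show ?thesis by (auto elim!: eventually_mono)
  qed
  then have "AE x in M. \<forall>n. x \<in> C n \<longrightarrow> 0 < fst (F x)" unfolding AE_all_countable by blast
  moreover have "AE x in M. x \<in> space M" by (rule AE_space)
  ultimately show ?thesis
    by eventually_elim (use C(3) in \<open>auto simp: space_restrict_space\<close>)
qed

lemma mass_positive:
  assumes lam: "p \<le> lam" and F: "minimiser lam F" and ne: "\<Omega> \<noteq> {}"
  shows "0 < mass F"
proof -
  have FK: "F \<in> K" using F by (simp add: minimiser_def)
  have i: "integrable M (\<lambda>x. (fst (F x))\<^sup>2)"
    using l2_integrable[OF l2_components(1)[OF K_l2[OF FK]]] by simp
  have "mass F \<noteq> 0"
  proof
    assume "mass F = 0"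
    then have "AE x in M. (fst (F x))\<^sup>2 = 0"
      unfolding mass_def using i by (subst (asm) integral_nonneg_eq_0_iff_AE) auto
    then have "AE x in M. False" using minimiser_positive[OF lam F] by eventually_elim simp
    then have "AE x in lebesgue. x \<notin> \<Omega>"
      using \<Omega>_sets by (subst (asm) AE_restrict_space_iff) auto
    then have "negligible \<Omega>"
      using \<Omega>_sets by (simp add: negligible_iff_null_sets AE_iff_null_sets)
    then show False using open_not_negligible[OF open_\<Omega> ne] by simp
  qed
  moreover have "0 \<le> mass F" by (simp add: mass_def)
  ultimately show ?thesis by simp
qed

text \<open>The threshold is the mass at the admissible multiplier \<open>L\<close>; smaller masses
  are found at larger multipliers. The choice made by \<open>SOME\<close> does not affect the mass,
  because \<open>mass_lipschitz\<close> holds for any two minimisers.\<close>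

lemma exists_minimiser_of_mass:
  assumes ne: "\<Omega> \<noteq> {}"
  shows "\<exists>\<rho>0>0. \<forall>\<rho>. 0 < \<rho> \<and> \<rho> < \<rho>0 \<longrightarrow>
    (\<exists>lam F. p \<le> lam \<and> 6 \<le> lam \<and> minimiser lam F \<and> mass F = \<rho>)"
proof -
  define \<Phi> where "\<Phi> lam = (SOME F. minimiser lam F)" for lam
  have \<Phi>: "minimiser lam (\<Phi> lam)" if "p \<le> lam" for lam
    unfolding \<Phi>_def using minimiser_exists[OF that] by (rule someI_ex)
  define m where "m lam = mass (\<Phi> lam)" for lam
  \<comment> \<open>Large enough for both requirements on the multiplier, p for strong convexity and
    6 for the upper bound.\<close>
  define L where "L = p + 6"
  have L: "p \<le> L" "6 \<le> L" using p by (auto simp: L_def)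
  have "continuous_on {L..} m"
  proof (rule lipschitz_on_continuous_on[OF lipschitz_onI])
    show "dist (m x) (m y) \<le> 4 * measure M (space M) * dist x y" if "x \<in> {L..}" "y \<in> {L..}" for x y
      using mass_lipschitz[OF _ _ \<Phi> \<Phi>, of x y] that L by (simp add: m_def dist_real_def)
  qed simp
  have pos: "0 < m L" unfolding m_def by (rule mass_positive[OF L(1) \<Phi>[OF L(1)] ne])
  have main: "\<forall>\<rho>. 0 < \<rho> \<and> \<rho> < m L \<longrightarrow>
    (\<exists>lam F. p \<le> lam \<and> 6 \<le> lam \<and> minimiser lam F \<and> mass F = \<rho>)"
  proof (intro allI impI)
    fix \<rho> assume \<rho>: "0 < \<rho> \<and> \<rho> < m L"
    let ?c = "(1 + 1 / (1 - r)) * measure M (space M)"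
    \<comment> \<open>Chosen so that \<open>mass_upper\<close> forces the mass at \<Lambda> to be at
      most \<rho>.\<close>
    define \<Lambda> where "\<Lambda> = max L (2 * ?c / \<rho>)"
    have \<Lambda>: "L \<le> \<Lambda>" "0 < \<Lambda>" using L by (auto simp: \<Lambda>_def)
    have "m \<Lambda> \<le> \<rho>"
    proof -
      have "2 * ?c / \<rho> \<le> \<Lambda>" by (simp add: \<Lambda>_def)
      then have "?c \<le> \<Lambda> / 2 * \<rho>" using \<rho> by (simp add: field_simps)
      moreover have "\<Lambda> / 2 * m \<Lambda> \<le> ?c"
        unfolding m_def using mass_upper[OF _ \<Phi>, of \<Lambda>] \<Lambda> L by simp
      ultimately have "\<Lambda> / 2 * m \<Lambda> \<le> \<Lambda> / 2 * \<rho>" by linarith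
      then show ?thesis using \<Lambda> by (simp add: mult_le_cancel_left)
    qed
    then obtain lam where lam: "L \<le> lam" "lam \<le> \<Lambda>" "m lam = \<rho>"
      using IVT2'[of m \<Lambda> \<rho> L] \<rho> \<Lambda> continuous_on_subset[OF \<open>continuous_on {L..} m\<close>, of "{L..\<Lambda>}"] by auto
    then show "\<exists>lam F. p \<le> lam \<and> 6 \<le> lam \<and> minimiser lam F \<and> mass F = \<rho>"
      using L \<Phi>[of lam] unfolding m_def by (intro exI[of _ lam] exI[of _ "\<Phi> lam"]) auto
  qed
  from pos main show ?thesis by blast
qed

text \<open>A minimiser is positive only almost everywhere, while u > 0 is wanted at every point. A
  change on a null set repairs this and leaves all integrals and membership in \<open>V\<close>
  intact.\<close>

lemma minimiser_weak_solution:
  assumes lam: "p \<le> lam" "6 \<le> lam" and F: "minimiser lam F"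
  shows "\<exists>u G. H01 \<Omega> u G \<and> (\<forall>x\<in>\<Omega>. u x > 0) \<and> integral\<^sup>L M (\<lambda>x. (u x)\<^sup>2) = mass F \<and>
    (\<forall>\<phi>. test_fun \<Omega> \<phi> \<longrightarrow> integrable M (\<lambda>x. u x powr (- r) * \<phi> x) \<and>
      integrable M (\<lambda>x. u x powr (p - 1) * \<phi> x) \<and>
      integral\<^sup>L M (\<lambda>x. G x \<bullet> grad \<phi> x) + lam * integral\<^sup>L M (\<lambda>x. u x * \<phi> x)
        = integral\<^sup>L M (\<lambda>x. u x powr (- r) * \<phi> x) + integral\<^sup>L M (\<lambda>x. u x powr (p - 1) * \<phi> x))"
proof -
  have FK: "F \<in> K" using F by (simp add: minimiser_def)
  note m[measurable] = borel_measurable_components[OF l2_measurable[OF K_l2[OF FK]]]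
  \<comment> \<open>The value 1 is an arbitrary positive default, taken only on a null subset of
    \<Omega>.\<close>
  define u where "u x = (if fst (F x) > 0 then fst (F x) else 1)" for x
  define G where "G x = snd (F x)" for x
  have um[measurable]: "u \<in> borel_measurable M" unfolding u_def[abs_def] by measurable
  have ae: "AE x in M. u x = fst (F x)"
    using minimiser_positive[OF lam(1) F] by eventually_elim (simp add: u_def)
  have "(\<lambda>x. (u x, G x)) \<in> V"
  proof (rule V_cong_AE[OF K_V[OF FK]])
    have "(\<lambda>x. (u x, G x)) \<in> borel_measurable M"
      unfolding G_def by (intro borel_measurable_Pair um m)
    moreover have "AE x in M. norm (u x, G x) \<le> norm (F x)"
      using ae by eventually_elim (simp add: G_def)
    ultimately show "l2 M (\<lambda>x. (u x, G x))" by (rule l2_bound(1)[OF K_l2[OF FK]])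
    show "AE x in M. F x = (u x, G x)" using ae by eventually_elim (simp add: G_def prod_eq_iff)
  qed
  then have H: "H01 \<Omega> u G" using V_H01 by fastforce
  have mass: "integral\<^sup>L M (\<lambda>x. (u x)\<^sup>2) = mass F"
    unfolding mass_def by (rule integral_cong_AE) (use ae in auto)
  have "integrable M (\<lambda>x. u x powr (- r) * \<phi> x) \<and>
      integrable M (\<lambda>x. u x powr (p - 1) * \<phi> x) \<and>
      integral\<^sup>L M (\<lambda>x. G x \<bullet> grad \<phi> x) + lam * integral\<^sup>L M (\<lambda>x. u x * \<phi> x)
        = integral\<^sup>L M (\<lambda>x. u x powr (- r) * \<phi> x) + integral\<^sup>L M (\<lambda>x. u x powr (p - 1) * \<phi> x)"
    if \<phi>: "test_fun \<Omega> \<phi>" for \<phi>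
  proof -
    have [measurable]: "\<phi> \<in> borel_measurable M"
      by (intro l2_measurable l2_continuous smooth_on_continuous test_fun_smooth[OF \<phi>])
    note EL = minimiser_Euler_Lagrange[OF lam F \<phi>]
    have 1: "AE x in M. u x powr (- r) * \<phi> x = fst (F x) powr (- r) * \<phi> x"
      and 2: "AE x in M. u x powr (p - 1) * \<phi> x = fst (F x) powr (p - 1) * \<phi> x"
      and 3: "AE x in M. u x * \<phi> x = fst (F x) * \<phi> x"
      using ae by (eventually_elim, simp)+
    have "integrable M (\<lambda>x. u x powr (- r) * \<phi> x)" "integrable M (\<lambda>x. u x powr (p - 1) * \<phi> x)"
      using EL(1,2) integrable_cong_AE[OF _ _ 1] integrable_cong_AE[OF _ _ 2] by auto
    moreover have "integral\<^sup>L M (\<lambda>x. u x powr (- r) * \<phi> x) = integral\<^sup>L M (\<lambda>x. fst (F x) powr (- r) * \<phi> x)"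
      by (rule integral_cong_AE[OF _ _ 1]) measurable
    moreover have "integral\<^sup>L M (\<lambda>x. u x powr (p - 1) * \<phi> x) = integral\<^sup>L M (\<lambda>x. fst (F x) powr (p - 1) * \<phi> x)"
      by (rule integral_cong_AE[OF _ _ 2]) measurable
    moreover have "integral\<^sup>L M (\<lambda>x. u x * \<phi> x) = integral\<^sup>L M (\<lambda>x. fst (F x) * \<phi> x)"
      by (rule integral_cong_AE[OF _ _ 3]) measurable
    ultimately show ?thesis using EL(3) by (simp add: G_def)
  qed
  moreover have "\<forall>x\<in>\<Omega>. u x > 0" by (simp add: u_def)
  ultimately show ?thesis using H mass by blast
qed

end

theorem theorem1p1:
  fixes \<Omega> :: "(real^'n) set" and r p :: real
  assumes "CARD('n) \<ge> 3"
    and "smooth_bounded_domain \<Omega>"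
    and "0 < r" and "r < 1"
    and "2 + 4 / real CARD('n) < p"
    and "p < 2 * real CARD('n) / (real CARD('n) - 2)"
  shows "\<exists>\<rho>0>0. \<forall>\<rho>. 0 < \<rho> \<and> \<rho> < \<rho>0 \<longrightarrow>
    (\<exists>(lam::real) (u :: real^'n \<Rightarrow> real) G.
       H01 \<Omega> u G \<and> (\<forall>x\<in>\<Omega>. u x > 0) \<and>
       integral\<^sup>L (lebesgue_on \<Omega>) (\<lambda>x. (u x)\<^sup>2) = \<rho> \<and>
       (\<forall>\<phi>. test_fun \<Omega> \<phi> \<longrightarrow>
          integrable (lebesgue_on \<Omega>) (\<lambda>x. u x powr (-r) * \<phi> x) \<and>
          integrable (lebesgue_on \<Omega>) (\<lambda>x. u x powr (p - 1) * \<phi> x) \<and>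
          integral\<^sup>L (lebesgue_on \<Omega>) (\<lambda>x. G x \<bullet> grad \<phi> x)
            + lam * integral\<^sup>L (lebesgue_on \<Omega>) (\<lambda>x. u x * \<phi> x)
          = integral\<^sup>L (lebesgue_on \<Omega>) (\<lambda>x. u x powr (-r) * \<phi> x)
            + integral\<^sup>L (lebesgue_on \<Omega>) (\<lambda>x. u x powr (p - 1) * \<phi> x)))"
proof -
  have "0 \<le> 4 / real CARD('n)" by simp
  then have "2 \<le> p" using assms(5) by linarith
  moreover have "open \<Omega>" "bounded \<Omega>" and ne: "\<Omega> \<noteq> {}"
    using assms(2) by (auto simp: smooth_bounded_domain_def)
  ultimately interpret singular_problem \<Omega> p r
    using assms(3,4) by unfold_locales auto
  obtain \<rho>0 where \<rho>0: "\<rho>0 > 0" "\<And>\<rho>. 0 < \<rho> \<Longrightarrow> \<rho> < \<rho>0 \<Longrightarrow>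
      \<exists>lam F. p \<le> lam \<and> 6 \<le> lam \<and> minimiser lam F \<and> mass F = \<rho>"
    using exists_minimiser_of_mass[OF ne] by blast
  have "\<exists>lam u G. H01 \<Omega> u G \<and> (\<forall>x\<in>\<Omega>. u x > 0) \<and> integral\<^sup>L M (\<lambda>x. (u x)\<^sup>2) = \<rho> \<and>
    (\<forall>\<phi>. test_fun \<Omega> \<phi> \<longrightarrow> integrable M (\<lambda>x. u x powr (- r) * \<phi> x) \<and>
      integrable M (\<lambda>x. u x powr (p - 1) * \<phi> x) \<and>
      integral\<^sup>L M (\<lambda>x. G x \<bullet> grad \<phi> x) + lam * integral\<^sup>L M (\<lambda>x. u x * \<phi> x)
        = integral\<^sup>L M (\<lambda>x. u x powr (- r) * \<phi> x) + integral\<^sup>L M (\<lambda>x. u x powr (p - 1) * \<phi> x))"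
    if \<rho>: "0 < \<rho>" "\<rho> < \<rho>0" for \<rho>
  proof -
    obtain lam F where lam: "p \<le> lam" "6 \<le> lam" "minimiser lam F" and m: "mass F = \<rho>"
      using \<rho>0(2)[OF \<rho>] by blast
    show ?thesis using minimiser_weak_solution[OF lam] unfolding m by (rule exI[of _ lam])
  qed
  with \<rho>0(1) show ?thesis by blast
qed

end
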